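(* Let $n\in\mathbb{N}$, $1\leq q\leq\infty$, $x\in[a,b]$ and an integrable on $[a,b]$ function $p\colon[a,b]\to\mathbb{R}$ be given. Let $w_1,\ldots,w_n$ be positive functions on $[a,b]$ such that $w_k^{(n-k)}$ is absolutely continuous on $[a,b]$, $k=1,\ldots,n$. Then $$ \sup_{f\in\mathcal{D}^n_q[a,b]}\left|\int_a^b p(t)f(t)\,dt-\sum_{k=0}^{n-1}\left(\int_a^b r_x^k(t)w_{k+1}(t)\,dt\right)\frac{D_kf(x)}{w_{k+1}(x)}\right| =\sup_{\|g\|_{L_q[a,b]}\leq 1}\left|\int_a^b r_x^n(t)g(t)\,dt\right| =\|r_x^n\|_{L_{q'}[a,b]}, $$ where $1/q+1/q'=1$.
   Context: $[a,b]\subset\mathbb{R}$ is a compact interval, $a<b$. The differential operators $D_k$ are defined by $D_0f=f$ and $D_kf=\left(\frac{1}{w_k}D_{k-1}f\right)'$, $k=1,\ldots,n$. $\mathcal{D}^n_q[a,b]$ denotes the class of continuous functions $f\colon[a,b]\to\mathbb{R}$ such that $f^{(n-1)}$ exists and is absolutely continuous on $[a,b]$ (so that $D_nf$ is defined almost everywhere) and $\|D_nf\|_{L_q[a,b]}\leq 1$. For an integrable function $u\colon[a,b]\to\mathbb{R}$ define $r_x(u;\cdot)\colon[a,b]\to\mathbb{R}$ by $r_x(u;s)=-\int_a^s u(t)\,dt$ for $s\leq x$ and $r_x(u;s)=\int_s^b u(t)\,dt$ for $s>x$. The functions $r_x^k\colon[a,b]\to\mathbb{R}$ are defined by $r_x^0=p$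 and $r_x^k=r_x(w_kr_x^{k-1};\cdot)$, $k=1,\ldots,n$. *)

theory Defs
  imports "HOL-Analysis.Analysis" "HOL-Probability.Essential_Supremum"
begin

definition abs_cont_on :: "real \<Rightarrow> real \<Rightarrow> (real \<Rightarrow> real) \<Rightarrow> bool" where
  "abs_cont_on a b f \<longleftrightarrow>
    (\<forall>\<epsilon>>0. \<exists>\<delta>>0. \<forall>I :: (real \<times> real) set.
      finite I \<and> (\<forall>(u, v)\<in>I. a \<le> u \<and> u < v \<and> v \<le> b) \<and>
      pairwise (\<lambda>(u, v) (u', v'). {u<..<v} \<inter> {u'<..<v'} = {}) I \<and>
      (\<Sum>(u, v)\<in>I. v - u) < \<delta>
      \<longrightarrow> (\<Sum>(u, v)\<in>I. \<bar>f v - f u\<bar>) < \<epsilon>)"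

text \<open>Functions on the compact interval from \<open>a\<close> to \<open>b\<close> are represented by functions on the
  whole line whose values outside the interval play no role. Accordingly all derivatives are taken
  within the interval, hence are one-sided at the end points.\<close>

definition deriv_within :: "real \<Rightarrow> real \<Rightarrow> (real \<Rightarrow> real) \<Rightarrow> real \<Rightarrow> real" where
  "deriv_within a b f t = vector_derivative f (at t within {a..b})"

definition iter_deriv :: "real \<Rightarrow> real \<Rightarrow> nat \<Rightarrow> (real \<Rightarrow> real) \<Rightarrow> real \<Rightarrow> real" where
  "iter_deriv a b m f = (deriv_within a b ^^ m) f"

definition has_abs_cont_deriv :: "real \<Rightarrow> real \<Rightarrow> nat \<Rightarrow> (real \<Rightarrow> real) \<Rightarrow> bool" where
  "has_abs_cont_deriv a b m f \<longleftrightarrow>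
    (\<forall>j<m. iter_deriv a b j f differentiable_on {a..b}) \<and> abs_cont_on a b (iter_deriv a b m f)"

primrec D_op :: "real \<Rightarrow> real \<Rightarrow> (nat \<Rightarrow> real \<Rightarrow> real) \<Rightarrow> nat \<Rightarrow> (real \<Rightarrow> real) \<Rightarrow> real \<Rightarrow> real" where
  "D_op a b w 0 f = f"
| "D_op a b w (Suc k) f = deriv_within a b (\<lambda>t. 1 / w (Suc k) t * D_op a b w k f t)"

text \<open>Integrating with respect to Lebesgue (rather than Borel) measure makes \<open>D_op a b w n f\<close>
  insensitive to the arbitrary values it takes on the null set where the last derivative
  does not exist.\<close>

definition Lq_norm :: "real \<Rightarrow> real \<Rightarrow> ennreal \<Rightarrow> (real \<Rightarrow> real) \<Rightarrow> ennreal" where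
  "Lq_norm a b q g =
    (if q = \<infinity> then esssup (lebesgue_on {a..b}) (\<lambda>t. ennreal \<bar>g t\<bar>)
     else let J = \<integral>\<^sup>+ t. ennreal (\<bar>g t\<bar> powr enn2real q) \<partial>lebesgue_on {a..b}
          in if J = \<infinity> then \<infinity> else ennreal (enn2real J powr (1 / enn2real q)))"

definition Lq_unit_ball :: "real \<Rightarrow> real \<Rightarrow> ennreal \<Rightarrow> (real \<Rightarrow> real) set" where
  "Lq_unit_ball a b q = {g \<in> borel_measurable (lebesgue_on {a..b}). Lq_norm a b q g \<le> 1}"

definition D_class ::
    "real \<Rightarrow> real \<Rightarrow> (nat \<Rightarrow> real \<Rightarrow> real) \<Rightarrow> nat \<Rightarrow> ennreal \<Rightarrow> (real \<Rightarrow> real) set" where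
  "D_class a b w n q =
    {f. continuous_on {a..b} f \<and> has_abs_cont_deriv a b (n - 1) f \<and>
        D_op a b w n f \<in> Lq_unit_ball a b q}"

definition r_op :: "real \<Rightarrow> real \<Rightarrow> real \<Rightarrow> (real \<Rightarrow> real) \<Rightarrow> real \<Rightarrow> real" where
  "r_op a b x u s =
    (if s \<le> x then - (LINT t:{a..s}|lebesgue. u t) else (LINT t:{s..b}|lebesgue. u t))"

primrec r_iter ::
    "real \<Rightarrow> real \<Rightarrow> real \<Rightarrow> (nat \<Rightarrow> real \<Rightarrow> real) \<Rightarrow> (real \<Rightarrow> real) \<Rightarrow> nat \<Rightarrow> real \<Rightarrow> real" where
  "r_iter a b x w p 0 = p"
| "r_iter a b x w p (Suc k) = r_op a b x (\<lambda>t. w (Suc k) t * r_iter a b x w p k t)"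

end

theory Submission
  imports Defs
begin

text \<open>Everything rests on one identity: for every \<open>f\<close> in the class, the error functional is the
integral of \<open>r_iter a b x w p n\<close> against \<open>D_op a b w n f\<close>. It comes from a single
integration by parts, applied \<open>n\<close> times. For an integrable \<open>u\<close>, the function
\<open>r_op a b x u\<close> is the antiderivative of \<open>-u\<close> that vanishes at \<open>a\<close>, up to the
point \<open>x\<close>, and the one that vanishes at \<open>b\<close>, beyond \<open>x\<close>. These two antiderivatives
differ by the integral of \<open>u\<close>, so for an absolutely continuous \<open>h\<close> the only boundary
term is \<open>h x\<close> times that integral (\<open>integral_mult_abs_cont\<close>). With
\<open>u = w\<^sub>k\<^sub>+\<^sub>1 r\<^sup>k\<close> and \<open>h = D\<^sub>k f / w\<^sub>k\<^sub>+\<^sub>1\<close>, whose derivative is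
\<open>D\<^sub>k\<^sub>+\<^sub>1 f\<close>, this splits off the \<open>k\<close>-th term of the sum and leaves an integral of the same
form with \<open>k + 1\<close> in place of \<open>k\<close> (\<open>remainder_step\<close>, \<open>remainder_formula\<close>).

The first equality of the theorem now says that \<open>D\<^sub>n\<close> maps the class onto the unit ball, up to
null sets: the equation \<open>D\<^sub>n f = g\<close> is solved by \<open>n\<close> successive weighted integrations
(\<open>prescribed_D_op\<close>). The second one is the duality between \<open>L\<^sub>q\<close> and its conjugate space,
for a kernel that is bounded because \<open>n \<ge> 1\<close> (\<open>Lq_duality\<close>).

The analytic substance lies in the last of the \<open>n\<close> integrations by parts. There
\<open>D\<^sub>n\<^sub>-\<^sub>1 f / w\<^sub>n\<close> is only absolutely continuous, and \<open>D\<^sub>n f\<close> exists only almost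
everywhere, so what is needed is the fundamental theorem of calculus for absolutely continuous
functions (\<open>abs_cont_on_fundamental_theorem\<close>). Its proof has two independent halves. An
absolutely continuous function is the integral of some density (\<open>abs_cont_on_density\<close>): by means
of its total variation it is a difference of two increasing absolutely continuous functions, and the
Stieltjes measure of such a function has a Radon-Nikodym density. Conversely, an indefinite
integral has its integrand as derivative almost everywhere (\<open>Lebesgue_differentiation\<close>), which
follows from Henstock's lemma and the Vitali covering theorem. The second half is also what makes
\<open>D\<^sub>n f = g\<close> hold almost everywhere for the solution constructed above.\<close>

section \<open>Absolutely continuous functions\<close>

text \<open>The families of intervals that the definition of absolute continuity quantifies over.\<close>

definition short_family :: "real \<Rightarrow> real \<Rightarrow> real \<Rightarrow> (real \<times> real) set \<Rightarrow> bool" where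
  "short_family a b \<delta> I \<longleftrightarrow> finite I \<and> (\<forall>(u, v)\<in>I. a \<le> u \<and> u < v \<and> v \<le> b) \<and>
     pairwise (\<lambda>(u, v) (u', v'). {u<..<v} \<inter> {u'<..<v'} = {}) I \<and> (\<Sum>(u, v)\<in>I. v - u) < \<delta>"

lemma abs_cont_on_iff:
  "abs_cont_on a b f \<longleftrightarrow>
     (\<forall>\<epsilon>>0. \<exists>\<delta>>0. \<forall>I. short_family a b \<delta> I \<longrightarrow> (\<Sum>(u, v)\<in>I. \<bar>f v - f u\<bar>) < \<epsilon>)"
  by (simp add: abs_cont_on_def short_family_def)

lemma abs_cont_onE:
  assumes "abs_cont_on a b f" "\<epsilon> > 0"
  obtains \<delta> where "\<delta> > 0" "\<And>I. short_family a b \<delta> I \<Longrightarrow> (\<Sum>(u, v)\<in>I. \<bar>f v - f u\<bar>) < \<epsilon>"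
  using assms unfolding abs_cont_on_iff by blast

lemma short_family_bounds:
  assumes "short_family a b \<delta> I" "(u, v) \<in> I"
  shows "a \<le> u" "u \<le> v" "v \<le> b"
  using assms by (auto simp: short_family_def)

lemma short_family_mono:
  assumes "short_family a b \<delta> I" "\<delta> \<le> \<delta>'" "a' \<le> a" "b \<le> b'"
  shows "short_family a' b' \<delta>' I"
  using assms unfolding short_family_def by fastforce

text \<open>The definition speaks of sets of nonempty intervals. Families met in practice are indexed, and
some of their members may be empty; this form accepts them directly. The index type is left
open since later uses index by a single point, by natural numbers, by pairs and by sets.\<close>

lemma abs_cont_on_indexed:
  assumes "abs_cont_on a b h" "\<epsilon> > 0"
  obtains \<delta> where "\<delta> > 0"
    "\<And>(K :: 'k set) l r. \<lbrakk>finite K; \<And>k. k \<in> K \<Longrightarrow> a \<le> l k \<and> l k \<le> r k \<and> r k \<le> b;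
       \<And>j k. \<lbrakk>j \<in> K; k \<in> K; j \<noteq> k\<rbrakk> \<Longrightarrow> {l j<..<r j} \<inter> {l k<..<r k} = {};
       (\<Sum>k\<in>K. r k - l k) < \<delta>\<rbrakk> \<Longrightarrow> (\<Sum>k\<in>K. \<bar>h (r k) - h (l k)\<bar>) < \<epsilon>"
proof -
  obtain \<delta> where "\<delta> > 0" and \<delta>: "\<And>I. short_family a b \<delta> I \<Longrightarrow> (\<Sum>(u, v)\<in>I. \<bar>h v - h u\<bar>) < \<epsilon>"
    using abs_cont_onE[OF assms] by blast
  have "(\<Sum>k\<in>K. \<bar>h (r k) - h (l k)\<bar>) < \<epsilon>"
    if K: "finite K" and lr: "\<And>k. k \<in> K \<Longrightarrow> a \<le> l k \<and> l k \<le> r k \<and> r k \<le> b"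
    and dis: "\<And>j k. \<lbrakk>j \<in> K; k \<in> K; j \<noteq> k\<rbrakk> \<Longrightarrow> {l j<..<r j} \<inter> {l k<..<r k} = {}"
    and len: "(\<Sum>k\<in>K. r k - l k) < \<delta>" for K :: "'k set" and l r
  proof -
    \<comment> \<open>Empty intervals contribute nothing, and the remaining ones are pairwise distinct.\<close>
    define K' where "K' = {k\<in>K. l k < r k}"
    define \<phi> where "\<phi> k = (l k, r k)" for k
    have sub: "K' \<subseteq> K" and fin: "finite K'" using K by (auto simp: K'_def)
    have inj: "inj_on \<phi> K'"
    proof (rule inj_onI)
      fix j k assume jk: "j \<in> K'" "k \<in> K'" "\<phi> j = \<phi> k"
      then have "{l j<..<r j} \<inter> {l k<..<r k} \<noteq> {}"
        using dense[of "l j" "r j"] by (auto simp: \<phi>_def K'_def)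
      then show "j = k" using dis[of j k] jk sub by blast
    qed
    have eq: "l k = r k" if "k \<in> K - K'" for k
      using that lr[of k] by (auto simp: K'_def)
    have "(\<Sum>(u, v)\<in>\<phi> ` K'. v - u) = (\<Sum>k\<in>K'. r k - l k)"
      by (subst sum.reindex[OF inj]) (simp add: \<phi>_def)
    also have "\<dots> = (\<Sum>k\<in>K. r k - l k)"
      by (rule sum.mono_neutral_left[OF K sub]) (simp add: eq)
    finally have 1: "(\<Sum>(u, v)\<in>\<phi> ` K'. v - u) < \<delta>" using len by simp
    have "(\<Sum>(u, v)\<in>\<phi> ` K'. \<bar>h v - h u\<bar>) < \<epsilon>"
    proof (rule \<delta>, unfold short_family_def, intro conjI)
      show "pairwise (\<lambda>(u, v) (u', v'). {u<..<v} \<inter> {u'<..<v'} = {}) (\<phi> ` K')"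
        using dis sub by (fastforce simp: pairwise_def \<phi>_def)
    qed (use fin lr 1 in \<open>auto simp: K'_def \<phi>_def\<close>)
    also have "(\<Sum>(u, v)\<in>\<phi> ` K'. \<bar>h v - h u\<bar>) = (\<Sum>k\<in>K'. \<bar>h (r k) - h (l k)\<bar>)"
      by (subst sum.reindex[OF inj]) (simp add: \<phi>_def)
    also have "\<dots> = (\<Sum>k\<in>K. \<bar>h (r k) - h (l k)\<bar>)"
      by (rule sum.mono_neutral_left[OF K sub]) (simp add: eq)
    finally show ?thesis .
  qed
  with \<open>\<delta> > 0\<close> show thesis by (rule that) 
qed

lemma abs_cont_on_uniform:
  assumes "abs_cont_on a b h" "\<epsilon> > 0"
  obtains \<delta> where "\<delta> > 0" "\<And>s t. \<lbrakk>a \<le> s; s \<le> t; t \<le> b; t - s < \<delta>\<rbrakk> \<Longrightarrow> \<bar>h t - h s\<bar> < \<epsilon>"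
proof -
  obtain \<delta> where d: "\<delta> > 0" and *: "\<And>(K :: unit set) l r. \<lbrakk>finite K; \<And>k. k \<in> K \<Longrightarrow> a \<le> l k \<and> l k \<le> r k \<and> r k \<le> b;
       \<And>j k. \<lbrakk>j \<in> K; k \<in> K; j \<noteq> k\<rbrakk> \<Longrightarrow> {l j<..<r j} \<inter> {l k<..<r k} = {};
       (\<Sum>k\<in>K. r k - l k) < \<delta>\<rbrakk> \<Longrightarrow> (\<Sum>k\<in>K. \<bar>h (r k) - h (l k)\<bar>) < \<epsilon>"
    by (rule abs_cont_on_indexed[OF assms, where 'k=unit]) blast
  show thesis
    using d *[of "{()}" "\<lambda>_. s" "\<lambda>_. t" for s t] by (intro that[of \<delta>]) auto
qed

lemma abs_cont_on_continuous:
  assumes "abs_cont_on a b h"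
  shows "continuous_on {a..b} h"
  unfolding continuous_on_iff dist_real_def
proof (intro ballI allI impI)
  fix x \<epsilon> :: real assume "x \<in> {a..b}" "\<epsilon> > 0"
  obtain \<delta> where d: "\<delta> > 0" "\<And>s t. \<lbrakk>a \<le> s; s \<le> t; t \<le> b; t - s < \<delta>\<rbrakk> \<Longrightarrow> \<bar>h t - h s\<bar> < \<epsilon>"
    using abs_cont_on_uniform[OF assms \<open>\<epsilon> > 0\<close>] by blast
  have "\<bar>h x' - h x\<bar> < \<epsilon>" if "x' \<in> {a..b}" "\<bar>x' - x\<bar> < \<delta>" for x'
    using d(2)[of x x'] d(2)[of x' x] that \<open>x \<in> {a..b}\<close> by (cases "x \<le> x'") auto
  then show "\<exists>d>0. \<forall>x'\<in>{a..b}. \<bar>x' - x\<bar> < d \<longrightarrow> \<bar>h x' - h x\<bar> < \<epsilon>"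
    using \<open>\<delta> > 0\<close> by blast
qed

text \<open>If the increments of \<open>h\<close> are controlled by those of \<open>f\<close> and \<open>g\<close>, a family that is
short enough for both of these is short enough for \<open>h\<close>. All closure properties below are
instances.\<close>

lemma abs_cont_on_dominated:
  assumes f: "abs_cont_on a b f" and g: "abs_cont_on a b g" and C: "C \<ge> 0"
    and le: "\<And>s t. \<lbrakk>a \<le> s; s \<le> t; t \<le> b\<rbrakk> \<Longrightarrow> \<bar>h t - h s\<bar> \<le> C * (\<bar>f t - f s\<bar> + \<bar>g t - g s\<bar>)"
  shows "abs_cont_on a b h"
  unfolding abs_cont_on_iff
proof (intro allI impI)
  fix \<epsilon> :: real assume "\<epsilon> > 0"
  define \<eta> where "\<eta> = \<epsilon> / (2 * (C + 1))"
  have "\<eta> > 0" using \<open>\<epsilon> > 0\<close> C by (simp add: \<eta>_def)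
  have "(C + 1) * 2 * \<eta> = \<epsilon>" 
    unfolding \<eta>_def using C by (subst times_divide_eq_right, subst nonzero_divide_eq_eq) (auto simp: algebra_simps)
  obtain d1 where d1: "d1 > 0"
    and 1: "\<And>I. short_family a b d1 I \<Longrightarrow> (\<Sum>(u, v)\<in>I. \<bar>f v - f u\<bar>) < \<eta>"
    using abs_cont_onE[OF f \<open>\<eta> > 0\<close>] by blast
  obtain d2 where d2: "d2 > 0"
    and 2: "\<And>I. short_family a b d2 I \<Longrightarrow> (\<Sum>(u, v)\<in>I. \<bar>g v - g u\<bar>) < \<eta>"
    using abs_cont_onE[OF g \<open>\<eta> > 0\<close>] by blast
  have "(\<Sum>(u, v)\<in>I. \<bar>h v - h u\<bar>) < \<epsilon>"
    if I: "short_family a b (min d1 d2) I" for I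
  proof -
    have "(\<Sum>(u, v)\<in>I. \<bar>h v - h u\<bar>) \<le> (\<Sum>(u, v)\<in>I. C * (\<bar>f v - f u\<bar> + \<bar>g v - g u\<bar>))"
      using short_family_bounds[OF I] by (intro sum_mono) (auto intro!: le)
    also have "\<dots> = C * ((\<Sum>(u, v)\<in>I. \<bar>f v - f u\<bar>) + (\<Sum>(u, v)\<in>I. \<bar>g v - g u\<bar>))"
      by (simp add: sum_distrib_left sum.distrib case_prod_unfold distrib_left)
    also have "\<dots> \<le> C * (\<eta> + \<eta>)"
      using 1[of I] 2[of I] short_family_mono[OF I] C
      by (intro mult_left_mono add_mono) (auto intro: less_imp_le)
    also have "\<dots> < (C + 1) * (\<eta> + \<eta>)"
      using \<open>\<eta> > 0\<close> by (intro mult_strict_right_mono) auto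
    also have "\<dots> = \<epsilon>"
      using \<open>(C + 1) * 2 * \<eta> = \<epsilon>\<close> by (simp add: algebra_simps)
    finally show ?thesis .
  qed
  then show "\<exists>\<delta>>0. \<forall>I. short_family a b \<delta> I \<longrightarrow> (\<Sum>(u, v)\<in>I. \<bar>h v - h u\<bar>) < \<epsilon>"
    using d1 d2 by (intro exI[of _ "min d1 d2"]) simp
qed

lemma abs_cont_on_id: "abs_cont_on a b (\<lambda>t. t)"
  unfolding abs_cont_on_iff
proof (intro allI impI)
  fix \<epsilon> :: real assume "\<epsilon> > 0"
  have "(\<Sum>(u, v)\<in>I. \<bar>v - u\<bar>) < \<epsilon>"
    if "short_family a b \<epsilon> I" for I
  proof -
    have "(\<Sum>(u, v)\<in>I. \<bar>v - u\<bar>) = (\<Sum>(u, v)\<in>I. v - u)"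
      using short_family_bounds[OF that] by (intro sum.cong) auto
    with that show ?thesis by (simp add: short_family_def)
  qed
  then show "\<exists>\<delta>>0. \<forall>I. short_family a b \<delta> I \<longrightarrow> (\<Sum>(u, v)\<in>I. \<bar>v - u\<bar>) < \<epsilon>"
    using \<open>\<epsilon> > 0\<close> by blast
qed

lemma abs_cont_on_Lipschitz:
  assumes "C \<ge> 0" "\<And>s t. \<lbrakk>a \<le> s; s \<le> t; t \<le> b\<rbrakk> \<Longrightarrow> \<bar>h t - h s\<bar> \<le> C * (t - s)"
  shows "abs_cont_on a b h"
proof (rule abs_cont_on_dominated[OF abs_cont_on_id abs_cont_on_id assms(1)])
  show "\<bar>h t - h s\<bar> \<le> C * (\<bar>t - s\<bar> + \<bar>t - s\<bar>)" if "a \<le> s" "s \<le> t" "t \<le> b" for s t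
  proof -
    have "C * (t - s) \<ge> 0" using that \<open>C \<ge> 0\<close> by simp
    then show ?thesis using assms(2)[OF that] that by (simp add: algebra_simps)
  qed
qed

lemma abs_cont_on_cong:
  assumes "abs_cont_on a b f" "\<And>t. t \<in> {a..b} \<Longrightarrow> f t = g t"
  shows "abs_cont_on a b g"
  by (rule abs_cont_on_dominated[OF assms(1) assms(1), of 1]) (auto simp: assms(2)[symmetric])

lemma abs_cont_on_const: "abs_cont_on a b (\<lambda>t. c)"
  by (rule abs_cont_on_Lipschitz[of 0]) auto

lemma abs_cont_on_add:
  assumes "abs_cont_on a b f" "abs_cont_on a b g"
  shows "abs_cont_on a b (\<lambda>t. f t + g t)"
  by (rule abs_cont_on_dominated[OF assms, of 1]) auto

lemma abs_cont_on_diff: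
  assumes "abs_cont_on a b f" "abs_cont_on a b g"
  shows "abs_cont_on a b (\<lambda>t. f t - g t)"
  by (rule abs_cont_on_dominated[OF assms, of 1]) auto

lemma abs_cont_on_bounded:
  assumes "abs_cont_on a b f"
  obtains B where "B \<ge> 0" "\<And>t. t \<in> {a..b} \<Longrightarrow> \<bar>f t\<bar> \<le> B"
proof -
  have "bounded (f ` {a..b})"
    by (intro compact_imp_bounded compact_continuous_image abs_cont_on_continuous assms) simp
  then obtain B where "\<And>t. t \<in> {a..b} \<Longrightarrow> \<bar>f t\<bar> \<le> B"
    unfolding bounded_iff by (metis imageI real_norm_def)
  then show thesis by (intro that[of "max 0 B"]) force+
qed

lemma abs_cont_on_mult:
  assumes f: "abs_cont_on a b f" and g: "abs_cont_on a b g"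
  shows "abs_cont_on a b (\<lambda>t. f t * g t)"
proof -
  obtain A B where A: "A \<ge> 0" "\<And>t. t \<in> {a..b} \<Longrightarrow> \<bar>f t\<bar> \<le> A"
    and B: "B \<ge> 0" "\<And>t. t \<in> {a..b} \<Longrightarrow> \<bar>g t\<bar> \<le> B"
    using abs_cont_on_bounded[OF f] abs_cont_on_bounded[OF g] by metis
  show ?thesis
  proof (rule abs_cont_on_dominated[OF f g, of "A + B"])
    fix s t assume st: "a \<le> s" "s \<le> t" "t \<le> b"
    have "f t * g t - f s * g s = f t * (g t - g s) + (f t - f s) * g s"
      by (simp add: algebra_simps)
    also have "\<bar>\<dots>\<bar> \<le> \<bar>f t\<bar> * \<bar>g t - g s\<bar> + \<bar>f t - f s\<bar> * \<bar>g s\<bar>"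
      by (metis abs_mult abs_triangle_ineq)
    also have "\<dots> \<le> (A + B) * \<bar>g t - g s\<bar> + \<bar>f t - f s\<bar> * (A + B)"
      using A(1) B(1) A(2)[of t] B(2)[of s] st by (intro add_mono mult_mono) auto
    finally show "\<bar>f t * g t - f s * g s\<bar> \<le> (A + B) * (\<bar>f t - f s\<bar> + \<bar>g t - g s\<bar>)"
      by (simp add: algebra_simps)
  qed (use A B in simp)
qed

lemma abs_cont_on_inverse:
  assumes f: "abs_cont_on a b f" and pos: "\<And>t. t \<in> {a..b} \<Longrightarrow> f t > 0"
  shows "abs_cont_on a b (\<lambda>t. 1 / f t)"
proof -
  have "continuous_on {a..b} (\<lambda>t. 1 / f t)"
    using abs_cont_on_continuous[OF f] pos by (intro continuous_intros) force+
  then have "bounded ((\<lambda>t. 1 / f t) ` {a..b})"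
    by (intro compact_imp_bounded compact_continuous_image) auto
  then obtain B' where B': "\<And>t. t \<in> {a..b} \<Longrightarrow> \<bar>1 / f t\<bar> \<le> B'"
    unfolding bounded_iff by (metis imageI real_norm_def)
  define B where "B = max 0 B'"
  have B: "B \<ge> 0" "\<And>t. t \<in> {a..b} \<Longrightarrow> \<bar>1 / f t\<bar> \<le> B"
    using B' by (force simp: B_def)+
  show ?thesis
  proof (rule abs_cont_on_dominated[OF f f, of "B * B"])
    fix s t assume st: "a \<le> s" "s \<le> t" "t \<le> b"
    have "1 / f t - 1 / f s = (1 / f t) * (1 / f s) * (f s - f t)"
      using pos[of s] pos[of t] st by (simp add: field_simps)
    also have "\<bar>\<dots>\<bar> = \<bar>1 / f t\<bar> * \<bar>1 / f s\<bar> * \<bar>f t - f s\<bar>"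
      by (simp only: abs_mult abs_minus_commute)
    also have "\<dots> \<le> B * B * \<bar>f t - f s\<bar>"
      using B(1) B(2)[of s] B(2)[of t] st by (intro mult_right_mono mult_mono) auto
    also have "\<dots> \<le> B * B * (\<bar>f t - f s\<bar> + \<bar>f t - f s\<bar>)"
      using B(1) by (intro mult_left_mono) auto
    finally show "\<bar>1 / f t - 1 / f s\<bar> \<le> B * B * (\<bar>f t - f s\<bar> + \<bar>f t - f s\<bar>)" .
  qed (use B in simp)
qed

section \<open>Total variation\<close>

text \<open>A partition is encoded as a monotone sequence cut off after \<open>N\<close> steps, repetitions being
allowed. Such sequences stay monotone when they are truncated with \<open>min\<close> or \<open>max\<close>, so a
partition can be divided at a point without any case analysis on its position.\<close>

definition polygonal_variation :: "(real \<Rightarrow> real) \<Rightarrow> (nat \<Rightarrow> real) \<Rightarrow> nat \<Rightarrow> real" where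
  "polygonal_variation h c N = (\<Sum>i<N. \<bar>h (c (Suc i)) - h (c i)\<bar>)"

definition total_variation :: "(real \<Rightarrow> real) \<Rightarrow> real \<Rightarrow> real \<Rightarrow> real" where
  "total_variation h s t = Sup {polygonal_variation h c N |c N. mono c \<and> range c \<subseteq> {s..t}}"

lemma mono_min_max:
  fixes c :: "nat \<Rightarrow> real"
  assumes "mono c"
  shows "mono (\<lambda>i. min z (c i))" "mono (\<lambda>i. max z (c i))"
  using assms by (auto intro!: monoI min.mono max.mono intro: monoD)

text \<open>Only the step that crosses \<open>z\<close> is changed by the truncations: it is replaced by two steps that
meet in \<open>z\<close>, and the triangle inequality applies.\<close>

lemma polygonal_variation_split:
  assumes "mono c"
  shows "polygonal_variation h c N \<le> polygonal_variation h (\<lambda>i. min z (c i)) N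
    + polygonal_variation h (\<lambda>i. max z (c i)) N"
proof -
  have "\<bar>h (c (Suc i)) - h (c i)\<bar> \<le> \<bar>h (min z (c (Suc i))) - h (min z (c i))\<bar>
      + \<bar>h (max z (c (Suc i))) - h (max z (c i))\<bar>" for i
  proof -
    have "c i \<le> c (Suc i)" using assms by (simp add: mono_iff_le_Suc)
    then show ?thesis by (auto simp: min_def max_def)
  qed
  then show ?thesis
    unfolding polygonal_variation_def sum.distrib[symmetric] by (intro sum_mono)
qed

text \<open>The inequality may be strict: running through \<open>c\<close> and then through \<open>d\<close> adds the step from the
last point of \<open>c\<close> to the first point of \<open>d\<close>.\<close>

lemma polygonal_variation_glue:
  assumes c: "mono c" "range c \<subseteq> {s..z}" and d: "mono d" "range d \<subseteq> {z..t}"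
  obtains e L where "mono e" "range e \<subseteq> {s..t}"
    "polygonal_variation h c N + polygonal_variation h d M \<le> polygonal_variation h e L"
proof -
  \<comment> \<open>The first \<open>N\<close> steps run through \<open>N + 1\<close> points, so \<open>d\<close> starts at index \<open>N + 1\<close>.\<close>
  define e where "e i = (if i \<le> N then c i else d (i - Suc N))" for i
  have cz: "s \<le> c i" "c i \<le> z" for i using c(2) by (auto simp: image_subset_iff)
  have dz: "z \<le> d i" "d i \<le> t" for i using d(2) by (auto simp: image_subset_iff)
  have le: "c i \<le> t" "s \<le> d i" for i
    using cz[of i] dz[of i] by linarith+
  have "mono e"
  proof (rule monoI)
    fix i j :: nat assume "i \<le> j"
    then show "e i \<le> e j"
      using c(1) d(1) order_trans[OF cz(2) dz(1)] by (auto simp: e_def mono_def)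
  qed
  moreover have "range e \<subseteq> {s..t}"
    using cz dz le by (auto simp: e_def)
  moreover have "polygonal_variation h c N + polygonal_variation h d M
      \<le> polygonal_variation h e (Suc N + M)"
  proof -
    have "polygonal_variation h e (Suc N + M)
        = polygonal_variation h e (Suc N) + polygonal_variation h d M"
      by (induction M) (simp_all add: polygonal_variation_def e_def)
    moreover have "polygonal_variation h e N = polygonal_variation h c N"
      unfolding polygonal_variation_def by (rule sum.cong) (auto simp: e_def)
    moreover have "polygonal_variation h e N \<le> polygonal_variation h e (Suc N)"
      by (simp add: polygonal_variation_def)
    ultimately show ?thesis by linarith
  qed
  ultimately show thesis by (rule that)
qed

lemma polygonal_variation_less:
  assumes "abs_cont_on a b h" "\<epsilon> > 0"
  obtains \<delta> where "\<delta> > 0" "\<And>c N s t. \<lbrakk>mono c; range c \<subseteq> {s..t}; a \<le> s; t \<le> b; t - s < \<delta>\<rbrakk>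
     \<Longrightarrow> polygonal_variation h c N < \<epsilon>"
proof -
  obtain \<delta> where d: "\<delta> > 0" and *: "\<And>(K :: nat set) l r. \<lbrakk>finite K; \<And>k. k \<in> K \<Longrightarrow> a \<le> l k \<and> l k \<le> r k \<and> r k \<le> b;
       \<And>j k. \<lbrakk>j \<in> K; k \<in> K; j \<noteq> k\<rbrakk> \<Longrightarrow> {l j<..<r j} \<inter> {l k<..<r k} = {};
       (\<Sum>k\<in>K. r k - l k) < \<delta>\<rbrakk> \<Longrightarrow> (\<Sum>k\<in>K. \<bar>h (r k) - h (l k)\<bar>) < \<epsilon>"
    by (rule abs_cont_on_indexed[OF assms, where 'k=nat]) blast
  have "polygonal_variation h c N < \<epsilon>"
    if c: "mono c" "range c \<subseteq> {s..t}" and st: "a \<le> s" "t \<le> b" "t - s < \<delta>" for c N s t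
    unfolding polygonal_variation_def
  proof (rule *)
    have in_st: "s \<le> c k \<and> c k \<le> t" for k using c(2) by (auto simp: image_subset_iff)
    show "a \<le> c k \<and> c k \<le> c (Suc k) \<and> c (Suc k) \<le> b" for k
      using in_st[of k] in_st[of "Suc k"] st monoD[OF c(1), of k "Suc k"] by auto
    show "{c j<..<c (Suc j)} \<inter> {c k<..<c (Suc k)} = {}" if "j \<noteq> k" for j k
      using monoD[OF c(1), of "Suc j" k] monoD[OF c(1), of "Suc k" j] that
      by (cases "j < k") (auto simp: disjoint_iff)
    show "(\<Sum>k<N. c (Suc k) - c k) < \<delta>"
      using in_st[of 0] in_st[of N] st by (simp add: sum_lessThan_telescope)
  qed simp
  with d show thesis by (rule that)
qed

text \<open>Absolute continuity implies bounded variation. This is what makes the supremum in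
\<open>total_variation\<close> a least upper bound.\<close>

lemma polygonal_variation_bounded:
  assumes "abs_cont_on a b h"
  obtains B where "\<And>c N. \<lbrakk>mono c; range c \<subseteq> {a..b}\<rbrakk> \<Longrightarrow> polygonal_variation h c N \<le> B"
proof -
  obtain \<delta> where d: "\<delta> > 0" and *: "\<And>c N s t. \<lbrakk>mono c; range c \<subseteq> {s..t}; a \<le> s; t \<le> b; t - s < \<delta>\<rbrakk>
     \<Longrightarrow> polygonal_variation h c N < 1"
    using polygonal_variation_less[OF assms, of 1] by (metis zero_less_one)
  \<comment> \<open>An interval that splits into \<open>m\<close> pieces shorter than \<open>\<delta>\<close> carries variation at most \<open>m\<close>.\<close>
  have "polygonal_variation h c N \<le> real m"
    if "mono c" "range c \<subseteq> {a..t}" "t \<le> b" "t - a \<le> real m * (\<delta> / 2)" for m c N t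
    using that
  proof (induction m arbitrary: c t)
    case 0
    then have "c i = a" for i using rangeI[of c i] by force
    then show ?case by (simp add: polygonal_variation_def)
  next
    case (Suc m)
    define z where "z = max a (t - \<delta> / 2)"
    have at: "a \<le> t" using rangeI[of c 0] Suc.prems(2) by force
    have ct: "a \<le> c i \<and> c i \<le> t" for i using Suc.prems(2) by (auto simp: image_subset_iff)
    have "polygonal_variation h (\<lambda>i. min z (c i)) N \<le> real m"
    proof (rule Suc.IH)
      show "range (\<lambda>i. min z (c i)) \<subseteq> {a..z}" using ct by (auto simp: z_def)
      show "z - a \<le> real m * (\<delta> / 2)" 
      proof (cases "a \<le> t - \<delta> / 2")
        case True
        then show ?thesis using Suc.prems(4) by (simp add: z_def distrib_right)
      next
        case False
        then show ?thesis using d by (simp add: z_def)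
      qed
    qed (use Suc.prems d at in \<open>auto simp: z_def intro: mono_min_max\<close>)
    moreover have "polygonal_variation h (\<lambda>i. max z (c i)) N < 1"
    proof (rule *[of _ z t])
      show "range (\<lambda>i. max z (c i)) \<subseteq> {z..t}" using ct at d by (auto simp: z_def)
    qed (use Suc.prems d at in \<open>auto simp: z_def intro: mono_min_max\<close>)
    ultimately show ?case
      using polygonal_variation_split[OF Suc.prems(1), of h N z] by simp
  qed
  moreover obtain m :: nat where "(b - a) / (\<delta> / 2) \<le> real m" using real_arch_simple by blast
  then have "b - a \<le> real m * (\<delta> / 2)" using d by (simp add: field_simps)
  ultimately show thesis by (intro that[of "real m"]) blast
qed

lemma polygonal_variation_le_total:
  assumes h: "abs_cont_on a b h" and "a \<le> s" "t \<le> b" "mono c" "range c \<subseteq> {s..t}"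
  shows "polygonal_variation h c N \<le> total_variation h s t"
proof -
  obtain B where B: "\<And>c N. \<lbrakk>mono c; range c \<subseteq> {a..b}\<rbrakk> \<Longrightarrow> polygonal_variation h c N \<le> B"
    using polygonal_variation_bounded[OF h] by blast
  have "{s..t} \<subseteq> {a..b}" using assms by auto
  then have "bdd_above {polygonal_variation h c N |c N. mono c \<and> range c \<subseteq> {s..t}}"
    by (intro bdd_aboveI[of _ B]) (use B in blast)
  then show ?thesis
    unfolding total_variation_def by (intro cSup_upper) (use assms in auto)
qed

lemma total_variation_approx:
  assumes "s \<le> t" "e > 0"
  obtains c N where "mono c" "range c \<subseteq> {s..t}"
    "total_variation h s t < polygonal_variation h c N + e"
proof -
  let ?S = "{polygonal_variation h c N |c N. mono c \<and> range c \<subseteq> {s..t}}"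
  have "polygonal_variation h (\<lambda>_. s) 0 \<in> ?S"
    using \<open>s \<le> t\<close> by (auto simp: mono_def intro!: exI[of _ "\<lambda>_. s"])
  then have "?S \<noteq> {}" by blast
  moreover have "total_variation h s t - e < Sup ?S"
    using \<open>e > 0\<close> by (simp add: total_variation_def)
  ultimately obtain y where "y \<in> ?S" "total_variation h s t - e < y"
    using less_cSupE by blast
  then obtain c N where "y = polygonal_variation h c N" "mono c" "range c \<subseteq> {s..t}" by auto
  then show thesis using \<open>total_variation h s t - e < y\<close> by (intro that[of c N]) auto
qed

lemma total_variation_ge:
  assumes h: "abs_cont_on a b h" and "a \<le> s" "s \<le> t" "t \<le> b"
  shows "\<bar>h t - h s\<bar> \<le> total_variation h s t"
proof -
  let ?c = "\<lambda>i::nat. if i = 0 then s else t"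
  have "polygonal_variation h ?c 1 \<le> total_variation h s t"
    using assms by (intro polygonal_variation_le_total[OF h]) (auto simp: mono_def)
  then show ?thesis by (simp add: polygonal_variation_def)
qed

lemma total_variation_split:
  assumes h: "abs_cont_on a b h" and "a \<le> s" "s \<le> z" "z \<le> t" "t \<le> b"
  shows "total_variation h s t = total_variation h s z + total_variation h z t"
proof (rule antisym)
  show "total_variation h s t \<le> total_variation h s z + total_variation h z t"
  proof (rule field_le_epsilon)
    fix e :: real assume "e > 0"
    obtain c N where c: "mono c" "range c \<subseteq> {s..t}"
      and less: "total_variation h s t < polygonal_variation h c N + e"
      using total_variation_approx[of s t e h] \<open>e > 0\<close> assms by auto
    have ct: "s \<le> c i \<and> c i \<le> t" for i using c(2) by (auto simp: image_subset_iff)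
    have "polygonal_variation h (\<lambda>i. min z (c i)) N \<le> total_variation h s z"
      using assms ct
      by (intro polygonal_variation_le_total[OF h] mono_min_max c(1)) auto
    moreover have "polygonal_variation h (\<lambda>i. max z (c i)) N \<le> total_variation h z t"
      using assms ct
      by (intro polygonal_variation_le_total[OF h] mono_min_max c(1)) auto
    ultimately show "total_variation h s t \<le> total_variation h s z + total_variation h z t + e"
      using polygonal_variation_split[OF c(1), of h N z] less by linarith
  qed
next
  show "total_variation h s z + total_variation h z t \<le> total_variation h s t"
  proof (rule field_le_epsilon)
    fix e :: real assume "e > 0"
    then have "e / 2 > 0" by simp
    obtain c N where c: "mono c" "range c \<subseteq> {s..z}"
      and 1: "total_variation h s z < polygonal_variation h c N + e / 2"
      using total_variation_approx[of s z "e/2" h] \<open>e / 2 > 0\<close> assms by auto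
    obtain d M where d: "mono d" "range d \<subseteq> {z..t}"
      and 2: "total_variation h z t < polygonal_variation h d M + e / 2"
      using total_variation_approx[of z t "e/2" h] \<open>e / 2 > 0\<close> assms by auto
    obtain g L where g: "mono g" "range g \<subseteq> {s..t}"
      and 3: "polygonal_variation h c N + polygonal_variation h d M \<le> polygonal_variation h g L"
      using polygonal_variation_glue[OF c d] by blast
    have "polygonal_variation h g L \<le> total_variation h s t"
      using g assms by (intro polygonal_variation_le_total[OF h])
    then show "total_variation h s z + total_variation h z t \<le> total_variation h s t + e"
      using 1 2 3 by linarith
  qed
qed

lemma total_variation_diff:
  assumes h: "abs_cont_on a b h" and "a \<le> u" "u \<le> v" "v \<le> b"
  shows "total_variation h a v - total_variation h a u = total_variation h u v"
  using total_variation_split[OF h, of a u v] assms by simp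

text \<open>Over each interval of a short family, the total variation is attained up to a small error by some
partition. The steps of all these partitions together form an indexed family of disjoint
intervals whose total length is no larger, so absolute continuity of \<open>h\<close> applies to it.\<close>

lemma abs_cont_on_total_variation:
  assumes h: "abs_cont_on a b h"
  shows "abs_cont_on a b (total_variation h a)"
  unfolding abs_cont_on_iff
proof (intro allI impI)
  fix \<epsilon> :: real assume "\<epsilon> > 0"
  then have "\<epsilon> / 2 > 0" by simp
  obtain \<delta> where d: "\<delta> > 0" and *: "\<And>(K :: ((real \<times> real) \<times> nat) set) l r.
      \<lbrakk>finite K; \<And>k. k \<in> K \<Longrightarrow> a \<le> l k \<and> l k \<le> r k \<and> r k \<le> b;
       \<And>j k. \<lbrakk>j \<in> K; k \<in> K; j \<noteq> k\<rbrakk> \<Longrightarrow> {l j<..<r j} \<inter> {l k<..<r k} = {};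
       (\<Sum>k\<in>K. r k - l k) < \<delta>\<rbrakk> \<Longrightarrow> (\<Sum>k\<in>K. \<bar>h (r k) - h (l k)\<bar>) < \<epsilon> / 2"
    by (rule abs_cont_on_indexed[OF h \<open>\<epsilon> / 2 > 0\<close>, where 'k="(real \<times> real) \<times> nat"]) blast
  have "(\<Sum>(u, v)\<in>I. \<bar>total_variation h a v - total_variation h a u\<bar>) < \<epsilon>"
    if I: "short_family a b \<delta> I" for I
  proof -
    have fin: "finite I" using I by (simp add: short_family_def)
    note bd = short_family_bounds[OF I]
    \<comment> \<open>An error of \<open>e\<close> in each of the \<open>card I\<close> intervals adds up to less than \<open>\<epsilon> / 2\<close>.\<close>
    define e where "e = \<epsilon> / (2 * (real (card I) + 1))"
    have "e > 0" using \<open>\<epsilon> > 0\<close> by (simp add: e_def)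
    have "\<forall>p\<in>I. \<exists>c N. mono c \<and> range c \<subseteq> {fst p..snd p} \<and>
        total_variation h (fst p) (snd p) < polygonal_variation h c N + e"
    proof
      fix p assume "p \<in> I"
      then have "fst p \<le> snd p" using bd[of "fst p" "snd p"] by simp
      then show "\<exists>c N. mono c \<and> range c \<subseteq> {fst p..snd p} \<and>
        total_variation h (fst p) (snd p) < polygonal_variation h c N + e"
        by (rule total_variation_approx[OF _ \<open>e > 0\<close>]) blast
    qed
    then obtain c N where cN: "\<And>p. p \<in> I \<Longrightarrow> mono (c p) \<and> range (c p) \<subseteq> {fst p..snd p} \<and>
        total_variation h (fst p) (snd p) < polygonal_variation h (c p) (N p) + e"
      by metis
    define K where "K = (SIGMA p:I. {..<N p})"
    define l r where "l = (\<lambda>(p, i). c p i)" and "r = (\<lambda>(p, i). c p (Suc i))"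
    have c_step: "c p i \<le> c p (Suc i)" if "p \<in> I" for p i
      using cN[OF that] by (auto intro: monoD)
    have c_in: "fst p \<le> c p i" "c p i \<le> snd p" if "p \<in> I" for p i
      using cN[OF that] by (auto simp: image_subset_iff)
    have sum_K: "(\<Sum>k\<in>K. \<phi> k) = (\<Sum>p\<in>I. \<Sum>i<N p. \<phi> (p, i))" for \<phi> :: "_ \<Rightarrow> real"
      unfolding K_def using fin by (subst sum.Sigma) auto
    have "(\<Sum>k\<in>K. \<bar>h (r k) - h (l k)\<bar>) < \<epsilon> / 2"
    proof (rule *)
      show "finite K" using fin by (auto simp: K_def)
      show "a \<le> l k \<and> l k \<le> r k \<and> r k \<le> b" if kK: "k \<in> K" for k
      proof -
        obtain p i where k: "k = (p, i)" "p \<in> I" using kK unfolding K_def by blast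
        then show ?thesis
          using c_in[of p i] c_in[of p "Suc i"] c_step[of p i] bd[of "fst p" "snd p"]
          by (auto simp: l_def r_def)
      qed
      show "{l j<..<r j} \<inter> {l k<..<r k} = {}" if jk: "j \<in> K" "k \<in> K" "j \<noteq> k" for j k
      proof -
        obtain p i p' i' where k: "j = (p, i)" "k = (p', i')" "p \<in> I" "p' \<in> I"
          using jk unfolding K_def by blast
        show ?thesis
        proof (cases "p = p'")
          case True
          then have "i \<noteq> i'" using k jk by auto
          moreover have "mono (c p)" using cN[OF k(3)] by blast
          ultimately show ?thesis
            using monoD[of "c p" "Suc i" i'] monoD[of "c p" "Suc i'" i] True k
            by (cases "i < i'") (auto simp: disjoint_iff l_def r_def)
        next
          case False
          then have "{fst p<..<snd p} \<inter> {fst p'<..<snd p'} = {}"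
            using I k by (fastforce simp: short_family_def pairwise_def)
          moreover have "{l j<..<r j} \<subseteq> {fst p<..<snd p}" "{l k<..<r k} \<subseteq> {fst p'<..<snd p'}"
            using c_in[OF k(3), of i] c_in[OF k(3), of "Suc i"] c_in[OF k(4), of i']
              c_in[OF k(4), of "Suc i'"] k(1,2) by (auto simp: l_def r_def)
          ultimately show ?thesis by blast
        qed
      qed
      have "(\<Sum>k\<in>K. r k - l k) = (\<Sum>p\<in>I. c p (N p) - c p 0)"
        by (simp add: sum_K l_def r_def sum_lessThan_telescope)
      also have "\<dots> \<le> (\<Sum>p\<in>I. snd p - fst p)"
        using c_in by (intro sum_mono diff_mono) auto
      also have "\<dots> < \<delta>" using I by (simp add: short_family_def case_prod_unfold)
      finally show "(\<Sum>k\<in>K. r k - l k) < \<delta>" .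
    qed
    then have 1: "(\<Sum>p\<in>I. polygonal_variation h (c p) (N p)) < \<epsilon> / 2"
      by (simp add: sum_K l_def r_def polygonal_variation_def)
    have "(\<Sum>(u, v)\<in>I. \<bar>total_variation h a v - total_variation h a u\<bar>)
        = (\<Sum>p\<in>I. total_variation h (fst p) (snd p))"
    proof (rule sum.cong)
      fix p assume "p \<in> I"
      then have "a \<le> fst p" "fst p \<le> snd p" "snd p \<le> b" using bd[of "fst p" "snd p"] by auto
      then show "(case p of (u, v) \<Rightarrow> \<bar>total_variation h a v - total_variation h a u\<bar>)
          = total_variation h (fst p) (snd p)"
        using total_variation_diff[OF h, of "fst p" "snd p"] total_variation_ge[OF h, of "fst p" "snd p"]
        by (simp add: case_prod_unfold)
    qed simp
    also have "\<dots> \<le> (\<Sum>p\<in>I. polygonal_variation h (c p) (N p) + e)"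
      using cN by (intro sum_mono) (auto intro: less_imp_le)
    also have "\<dots> = (\<Sum>p\<in>I. polygonal_variation h (c p) (N p)) + real (card I) * e"
      by (simp add: sum.distrib)
    also have "real (card I) * e \<le> \<epsilon> / 2"
      using \<open>\<epsilon> > 0\<close> by (simp add: e_def field_simps)
    finally show ?thesis using 1 by linarith
  qed
  then show "\<exists>\<delta>>0. \<forall>I. short_family a b \<delta> I \<longrightarrow>
      (\<Sum>(u, v)\<in>I. \<bar>total_variation h a v - total_variation h a u\<bar>) < \<epsilon>"
    using d by blast
qed

text \<open>The increment of the total variation dominates the increment of \<open>h\<close> in absolute value, hence
both \<open>total_variation h a\<close> and its difference with \<open>h\<close> are increasing.\<close>

lemma abs_cont_on_monotone_decomposition:
  assumes h: "abs_cont_on a b h"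
  obtains V W where "abs_cont_on a b V" "abs_cont_on a b W" "mono_on {a..b} V" "mono_on {a..b} W"
    "\<And>t. h t = V t - W t"
proof
  let ?V = "total_variation h a"
  show V: "abs_cont_on a b ?V" by (rule abs_cont_on_total_variation[OF h])
  then show "abs_cont_on a b (\<lambda>t. ?V t - h t)" by (rule abs_cont_on_diff[OF _ h])
  have "\<bar>h v - h u\<bar> \<le> ?V v - ?V u" if "a \<le> u" "u \<le> v" "v \<le> b" for u v
    using total_variation_ge[OF h that] total_variation_diff[OF h that] by simp
  then show "mono_on {a..b} ?V" "mono_on {a..b} (\<lambda>t. ?V t - h t)"
    by (force intro!: mono_onI)+
qed simp

section \<open>Densities of absolutely continuous functions\<close>

text \<open>A null set has a countable cover by nonoverlapping intervals of small total length. Absolute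
continuity bounds the measure of every finite part of the cover by the same \<open>\<epsilon>\<close>, and
continuity from below extends the bound to the whole cover.\<close>

lemma abs_cont_on_null_set:
  fixes \<mu> :: "real measure"
  assumes V: "abs_cont_on a b V"
    and sets [measurable_cong, simp]: "sets \<mu> = sets borel"
    and Icc: "\<And>s t. \<lbrakk>a \<le> s; s \<le> t; t \<le> b\<rbrakk> \<Longrightarrow> emeasure \<mu> {s..t} = ennreal (V t - V s)"
    and N: "N \<in> sets borel" "N \<subseteq> {a..b}" "emeasure lborel N = 0"
  shows "emeasure \<mu> N = 0"
proof -
  have "emeasure \<mu> N \<le> ennreal \<epsilon>" if "\<epsilon> > 0" for \<epsilon> :: real
  proof -
    obtain \<delta> where d: "\<delta> > 0" and *: "\<And>(K :: real set set) l r. \<lbrakk>finite K; \<And>k. k \<in> K \<Longrightarrow> a \<le> l k \<and> l k \<le> r k \<and> r k \<le> b;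
       \<And>j k. \<lbrakk>j \<in> K; k \<in> K; j \<noteq> k\<rbrakk> \<Longrightarrow> {l j<..<r j} \<inter> {l k<..<r k} = {};
       (\<Sum>k\<in>K. r k - l k) < \<delta>\<rbrakk> \<Longrightarrow> (\<Sum>k\<in>K. \<bar>V (r k) - V (l k)\<bar>) < \<epsilon>"
      by (rule abs_cont_on_indexed[OF V \<open>\<epsilon> > 0\<close>, where 'k="real set"]) blast
    have null: "N \<in> null_sets lebesgue"
      using N by (intro null_sets_completionI) (auto simp: null_sets_def)
    then have "N \<in> lmeasurable" "measure lebesgue N = 0"
      by (auto intro: fmeasurableI_null_sets measure_eq_0_null_sets)
    moreover have "\<delta> / 2 > 0" using d by simp
    ultimately obtain D where D: "countable D"
      "\<And>K. K \<in> D \<Longrightarrow> K \<subseteq> cbox a b \<and> K \<noteq> {} \<and> (\<exists>c d. K = cbox c d)"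
      "pairwise (\<lambda>A B. interior A \<inter> interior B = {}) D"
      "N \<subseteq> \<Union>D" "\<Union>D \<in> lmeasurable" "measure lebesgue (\<Union>D) \<le> \<delta> / 2"
      using measurable_outer_intervals_bounded[of N a b "\<delta>/2"] N(2) by (smt (verit) box_real(2))
    have D_sets: "K \<in> sets borel" if "K \<in> D" for K
      using D(2)[OF that] by auto
    have fin: "emeasure \<mu> (\<Union>C) \<le> ennreal \<epsilon>" if C: "finite C" "C \<subseteq> D" for C
    proof -
      define l r :: "real set \<Rightarrow> real" where "l = Inf" and "r = Sup"
      have K: "K = {l K..r K} \<and> a \<le> l K \<and> l K \<le> r K \<and> r K \<le> b" if KC: "K \<in> C" for K
      proof -
        obtain c d where "K = {c..d}" "K \<noteq> {}" "K \<subseteq> {a..b}"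
          using D(2)[OF subsetD[OF C(2) KC]] unfolding box_real by blast
        then show ?thesis by (auto simp: l_def r_def)
      qed
      then have K_eq: "K = {l K..r K}" and K_bd: "a \<le> l K \<and> l K \<le> r K \<and> r K \<le> b"
        if "K \<in> C" for K using that by blast+
      have "C division_of \<Union>C"
        unfolding division_of_def
      proof (intro conjI ballI impI)
        show "\<exists>c d. K = cbox c d" if "K \<in> C" for K using D(2)[of K] C that by auto
        show "interior K1 \<inter> interior K2 = {}" if "K1 \<in> C" "K2 \<in> C" "K1 \<noteq> K2" for K1 K2
          using D(3) C that by (auto simp: pairwise_def)
      qed (use D(2) C in auto)
      then have "(\<Sum>K\<in>C. measure lebesgue K) = measure lebesgue (\<Union>C)"
        by (rule content_division)
      also have "\<dots> \<le> measure lebesgue (\<Union>D)"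
      proof (rule measure_mono_fmeasurable[OF Union_mono[OF C(2)] _ D(5)])
        have "\<Union>C \<in> sets borel" using C D_sets by (intro sets.finite_Union) auto
        then show "\<Union>C \<in> sets lebesgue" by simp
      qed
      also have "\<dots> < \<delta>" using D(6) d by simp
      finally have "(\<Sum>K\<in>C. measure lebesgue K) < \<delta>" .
      moreover have "(\<Sum>K\<in>C. measure lebesgue K) = (\<Sum>K\<in>C. r K - l K)"
      proof (rule sum.cong)
        fix K assume "K \<in> C"
        have "measure lebesgue K = measure lebesgue {l K..r K}"
          using arg_cong[OF K_eq[OF \<open>K \<in> C\<close>]] .
        then show "measure lebesgue K = r K - l K"
          using K_bd[OF \<open>K \<in> C\<close>] by simp
      qed simp
      ultimately have len: "(\<Sum>K\<in>C. r K - l K) < \<delta>" by simp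
      have less: "(\<Sum>K\<in>C. \<bar>V (r K) - V (l K)\<bar>) < \<epsilon>"
      proof (rule *[OF C(1) _ _ len])
        show "{l J<..<r J} \<inter> {l K<..<r K} = {}" if JK: "J \<in> C" "K \<in> C" "J \<noteq> K" for J K
        proof -
          have "interior J \<inter> interior K = {}"
            using D(3) C JK by (auto simp: pairwise_def)
          moreover have "interior J = {l J<..<r J}" "interior K = {l K<..<r K}"
            using arg_cong[OF K_eq[OF JK(1)], of interior] arg_cong[OF K_eq[OF JK(2)], of interior]
            by simp_all
          ultimately show ?thesis by simp
        qed
      qed (use K_bd in blast)
      moreover have "emeasure \<mu> (\<Union>C) \<le> (\<Sum>K\<in>C. emeasure \<mu> K)"
        using emeasure_subadditive_finite[of C "\<lambda>K. K" \<mu>] C D_sets by auto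
      moreover have "(\<Sum>K\<in>C. emeasure \<mu> K) \<le> (\<Sum>K\<in>C. ennreal \<bar>V (r K) - V (l K)\<bar>)"
      proof (rule sum_mono)
        fix K assume "K \<in> C"
        have "emeasure \<mu> K = emeasure \<mu> {l K..r K}"
          using arg_cong[OF K_eq[OF \<open>K \<in> C\<close>]] .
        then show "emeasure \<mu> K \<le> ennreal \<bar>V (r K) - V (l K)\<bar>"
          using K_bd[OF \<open>K \<in> C\<close>] Icc[of "l K" "r K"] by (auto intro: ennreal_leI)
      qed
      ultimately have "emeasure \<mu> (\<Union>C) \<le> ennreal (\<Sum>K\<in>C. \<bar>V (r K) - V (l K)\<bar>)"
        by simp
      also have "\<dots> \<le> ennreal \<epsilon>" using less by (intro ennreal_leI) simp
      finally show ?thesis .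
    qed
    show ?thesis
    proof (cases "D = {}")
      case False
      define A where "A n = \<Union> (from_nat_into D ` {..<n::nat})" for n
      have sub: "from_nat_into D ` {..<n} \<subseteq> D" for n
        using from_nat_into[OF False] by auto
      have "N \<subseteq> (\<Union>n. A n)"
      proof
        fix t assume "t \<in> N"
        then obtain K where "K \<in> D" "t \<in> K" using D(4) by auto
        moreover then obtain i where "K = from_nat_into D i"
          using from_nat_into_surj[OF D(1)] by metis
        ultimately have "t \<in> A (Suc i)" by (auto simp: A_def)
        then show "t \<in> (\<Union>n. A n)" by blast
      qed
      moreover have A_sets: "range A \<subseteq> sets \<mu>"
        using D_sets sub by (auto simp: A_def intro!: sets.finite_Union)
      ultimately have "emeasure \<mu> N \<le> emeasure \<mu> (\<Union>n. A n)"
        by (intro emeasure_mono) auto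
      also have "\<dots> = (SUP n. emeasure \<mu> (A n))"
        by (rule SUP_emeasure_incseq[OF A_sets, symmetric])
          (auto simp: A_def incseq_def intro: less_le_trans)
      also have "\<dots> \<le> ennreal \<epsilon>"
        using fin sub by (intro SUP_least) (auto simp: A_def)
      finally show ?thesis .
    qed (use D(4) in simp)
  qed
  then show ?thesis
    using ennreal_le_epsilon[of 0 "emeasure \<mu> N"] by (metis add_0 le_zero_eq ennreal_le_epsilon)
qed

text \<open>By the preceding lemma the Stieltjes measure of \<open>V\<close>, extended by constants beyond the interval,
is absolutely continuous with respect to Lebesgue measure; \<open>g\<close> is its Radon-Nikodym density.\<close>

lemma monotone_abs_cont_density:
  assumes "a \<le> b" and V: "abs_cont_on a b V" and mono: "mono_on {a..b} V"
  obtains g where "g absolutely_integrable_on {a..b}"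
    "\<And>s t. \<lbrakk>a \<le> s; s \<le> t; t \<le> b\<rbrakk> \<Longrightarrow> integral {s..t} g = V t - V s"
proof -
  \<comment> \<open>Stieltjes measures are built from functions on the whole line.\<close>
  define F where "F t = V (max a (min b t))" for t
  have mono_F: "F s \<le> F t" if "s \<le> t" for s t
    unfolding F_def using that \<open>a \<le> b\<close> by (intro mono_onD[OF mono]) auto
  have cont_F: "continuous_on UNIV F"
    unfolding F_def using \<open>a \<le> b\<close>
    by (intro continuous_on_compose2[OF abs_cont_on_continuous[OF V]] continuous_intros) auto
  define \<mu> where "\<mu> = interval_measure F"
  have sets_mu [measurable_cong, simp]: "sets \<mu> = sets borel" by (simp add: \<mu>_def)
  have Icc: "emeasure \<mu> {s..t} = ennreal (F t - F s)" if "s \<le> t" for s t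
    unfolding \<mu>_def by (rule emeasure_interval_measure_Icc[OF that mono_F cont_F])
  have F_eq: "F t = V t" if "t \<in> {a..b}" for t using that by (auto simp: F_def)
  have ac: "absolutely_continuous lborel \<mu>"
    unfolding absolutely_continuous_def
  proof
    fix N assume N: "N \<in> null_sets (lborel :: real measure)"
    have "(\<Union>n. {a - real n..a}) \<in> null_sets \<mu>"
      using \<open>a \<le> b\<close> by (intro null_sets_UN) (auto simp: null_sets_def Icc F_def)
    moreover have "(\<Union>n. {b..b + real n}) \<in> null_sets \<mu>"
      using \<open>a \<le> b\<close> by (intro null_sets_UN) (auto simp: null_sets_def Icc F_def)
    moreover have "N \<inter> {a..b} \<in> null_sets \<mu>"
    proof (rule null_setsI)
      show "emeasure \<mu> (N \<inter> {a..b}) = 0"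
      proof (rule abs_cont_on_null_set[OF V])
        show "emeasure \<mu> {s..t} = ennreal (V t - V s)" if "a \<le> s" "s \<le> t" "t \<le> b" for s t
          using Icc[OF that(2)] that by (simp add: F_eq)
        show "emeasure lborel (N \<inter> {a..b}) = 0"
          using null_set_Int2[OF N, of "{a..b}"] by auto
      qed (use N in auto)
    qed (use N in auto)
    ultimately have null: "(\<Union>n. {a - real n..a}) \<union> (\<Union>n. {b..b + real n}) \<union> (N \<inter> {a..b}) \<in> null_sets \<mu>"
      by (intro null_sets.Un)
    have sub: "N \<subseteq> (\<Union>n. {a - real n..a}) \<union> (\<Union>n. {b..b + real n}) \<union> (N \<inter> {a..b})"
    proof
      fix t assume "t \<in> N"
      obtain n where n: "\<bar>t - a\<bar> + \<bar>t - b\<bar> \<le> real n" using real_arch_simple by blast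
      consider "t < a" | "t > b" | "t \<in> {a..b}" by force
      then show "t \<in> (\<Union>n. {a - real n..a}) \<union> (\<Union>n. {b..b + real n}) \<union> (N \<inter> {a..b})"
      proof cases
        case 1 then have "t \<in> {a - real n..a}" using n by auto
        then show ?thesis by (intro UnI1 UN_I[of n]) auto
      next
        case 2 then have "t \<in> {b..b + real n}" using n by auto
        then show ?thesis by (intro UnI1[OF UnI2] UN_I[of n]) auto
      qed (use \<open>t \<in> N\<close> in auto)
    qed
    have "N \<in> sets \<mu>" using null_setsD2[OF N] by simp
    from null_sets_subset[OF null this sub] show "N \<in> null_sets \<mu>" .
  qed
  then obtain f where f [measurable]: "f \<in> borel_measurable lborel" and dens: "density lborel f = \<mu>"
    using sigma_finite_measure.Radon_Nikodym[OF sigma_finite_lborel ac] by auto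
  \<comment> \<open>The density may be infinite, but on the interval only on a null set, as its integral is finite.\<close>
  define g where "g t = enn2real (f t)" for t
  have gm [measurable]: "g \<in> borel_measurable borel" using f unfolding g_def by measurable
  have nn_f: "(\<integral>\<^sup>+ u. f u * indicator {s..t} u \<partial>lborel) = ennreal (F t - F s)" if "s \<le> t" for s t
    using Icc[OF that] by (simp add: dens[symmetric] emeasure_density)
  have fin: "AE u in lborel. f u * indicator {a..b} u \<noteq> \<infinity>"
    by (rule nn_integral_PInf_AE) (simp_all add: nn_f \<open>a \<le> b\<close>)
  have nn_g: "(\<integral>\<^sup>+ u. ennreal (indicator {s..t} u * g u) \<partial>lborel) = ennreal (F t - F s)"
    if "a \<le> s" "s \<le> t" "t \<le> b" for s t
  proof -
    have "(\<integral>\<^sup>+ u. ennreal (indicator {s..t} u * g u) \<partial>lborel) = (\<integral>\<^sup>+ u. f u * indicator {s..t} u \<partial>lborel)"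
    proof (rule nn_integral_cong_AE, use fin in eventually_elim)
      case (elim u)
      then show ?case using that by (auto simp: indicator_def g_def less_top split: if_splits)
    qed
    then show ?thesis using nn_f[OF that(2)] by simp
  qed
  have int: "set_integrable lborel {s..t} g" if "a \<le> s" "s \<le> t" "t \<le> b" for s t
    unfolding set_integrable_def
    by (rule integrableI_nonneg) (use nn_g[OF that] in \<open>auto simp: g_def\<close>)
  have "integral {s..t} g = V t - V s" if st: "a \<le> s" "s \<le> t" "t \<le> b" for s t
  proof -
    have "integral {s..t} g = (LINT u:{s..t}|lborel. g u)"
      using set_borel_integral_eq_integral(2)[OF int[OF st]] by simp
    also have "\<dots> = enn2real (\<integral>\<^sup>+ u. ennreal (indicator {s..t} u * g u) \<partial>lborel)"
      unfolding set_lebesgue_integral_def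
      by (subst integral_eq_nn_integral) (auto simp: g_def)
    also have "\<dots> = V t - V s"
      using nn_g[OF st] mono_F[OF st(2)] st by (simp add: F_eq)
    finally show ?thesis .
  qed
  moreover have "g absolutely_integrable_on {a..b}"
    using int[OF order_refl \<open>a \<le> b\<close> order_refl]
    unfolding set_integrable_def by (subst integrable_completion) auto
  ultimately show thesis by (intro that[of g])
qed

proposition abs_cont_on_density:
  assumes "a \<le> b" and h: "abs_cont_on a b h"
  obtains g where "g absolutely_integrable_on {a..b}"
    "\<And>s t. \<lbrakk>a \<le> s; s \<le> t; t \<le> b\<rbrakk> \<Longrightarrow> integral {s..t} g = h t - h s"
proof -
  obtain V W where VW: "abs_cont_on a b V" "abs_cont_on a b W" "mono_on {a..b} V" "mono_on {a..b} W"
    and h_eq: "\<And>t. h t = V t - W t"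
    using abs_cont_on_monotone_decomposition[OF h] by blast
  obtain v where v: "v absolutely_integrable_on {a..b}"
    "\<And>s t. \<lbrakk>a \<le> s; s \<le> t; t \<le> b\<rbrakk> \<Longrightarrow> integral {s..t} v = V t - V s"
    using monotone_abs_cont_density[OF \<open>a \<le> b\<close> VW(1,3)] by blast
  obtain w where w: "w absolutely_integrable_on {a..b}"
    "\<And>s t. \<lbrakk>a \<le> s; s \<le> t; t \<le> b\<rbrakk> \<Longrightarrow> integral {s..t} w = W t - W s"
    using monotone_abs_cont_density[OF \<open>a \<le> b\<close> VW(2,4)] by blast
  show thesis
  proof (rule that[of "\<lambda>t. v t - w t"])
    show "(\<lambda>t. v t - w t) absolutely_integrable_on {a..b}"
      by (rule set_integral_diff(1)[OF v(1) w(1)])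
    show "integral {s..t} (\<lambda>t. v t - w t) = h t - h s" if "a \<le> s" "s \<le> t" "t \<le> b" for s t
    proof -
      have "v integrable_on {s..t}" "w integrable_on {s..t}"
        using v(1) w(1) that
        by (auto intro: integrable_on_subinterval set_lebesgue_integral_eq_integral(1))
      then show ?thesis
        using that by (simp add: integral_diff v(2) w(2) h_eq)
    qed
  qed
qed

section \<open>Lebesgue's differentiation theorem\<close>

lemma abs_integrable_subinterval:
  fixes f :: "real \<Rightarrow> real"
  assumes "f absolutely_integrable_on {a..b}" "a \<le> s" "t \<le> b"
  shows "f absolutely_integrable_on {s..t}" "f integrable_on {s..t}"
proof -
  show "f absolutely_integrable_on {s..t}"
    using assms by (intro absolutely_integrable_on_subinterval[OF assms(1)]) auto
  then show "f integrable_on {s..t}" by (rule set_lebesgue_integral_eq_integral(1))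
qed

lemma integral_diff_interval:
  fixes f :: "real \<Rightarrow> real"
  assumes "f integrable_on {a..b}" "a \<le> s" "s \<le> t" "t \<le> b"
  shows "integral {s..t} f = integral {a..t} f - integral {a..s} f"
proof -
  have "f integrable_on {a..t}"
    using assms by (intro integrable_on_subinterval[OF assms(1)]) auto
  from Henstock_Kurzweil_Integration.integral_combine[OF assms(2,3) this] show ?thesis by simp
qed

text \<open>A point of the exceptional set is an end point of arbitrarily short intervals over which the
integral of \<open>f\<close> deviates from the one-term Riemann sum by more than \<open>\<eta>\<close> times the length.
Disjoint intervals of this kind that obey the gauge form a fine tagged partial division, so
Henstock's lemma bounds the sum of the deviations by \<open>e * \<eta>\<close> and therefore the sum of the
lengths by \<open>e\<close>. By Vitali's theorem countably many of them cover almost all of the set.\<close>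

lemma negligible_large_difference_quotient:
  fixes f :: "real \<Rightarrow> real"
  assumes f: "f integrable_on {a..b}" and "\<eta> > 0"
  defines "F \<equiv> \<lambda>t. integral {a..t} f"
  shows "negligible {t\<in>{a..b}. \<forall>d>0. \<exists>s\<in>{a..b}. s \<noteq> t \<and> \<bar>s - t\<bar> < d \<and>
           \<eta> * \<bar>s - t\<bar> < \<bar>F s - F t - f t * (s - t)\<bar>}" (is "negligible ?E")
  unfolding negligible_outer_le
proof (intro allI impI)
  fix e :: real assume "e > 0"
  then have "e * \<eta> > 0" using \<open>\<eta> > 0\<close> by simp
  have "f integrable_on cbox a b" using f by simp
  then obtain \<gamma> where \<gamma>: "gauge \<gamma>" and Henstock:
      "\<And>p. \<lbrakk>p tagged_partial_division_of (cbox a b); \<gamma> fine p\<rbrakk> \<Longrightarrow>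
             (\<Sum>(x,k)\<in>p. norm (measure lborel k *\<^sub>R f x - integral k f)) < e * \<eta>"
    using Henstock_lemma[OF _ \<open>e * \<eta> > 0\<close>] by blast
  define seg :: "real \<times> real \<Rightarrow> real set" where "seg = (\<lambda>(t, s). {min t s..max t s})"
  define mid rad :: "real \<times> real \<Rightarrow> real"
    where "mid = (\<lambda>(t, s). (t + s) / 2)" and "rad = (\<lambda>(t, s). \<bar>s - t\<bar> / 2)"
  \<comment> \<open>A pair \<open>(t, s)\<close> stands for the interval between \<open>t\<close> and \<open>s\<close>, tagged at its end point \<open>t\<close>.\<close>
  define K where "K = {(t, s). t \<in> {a..b} \<and> s \<in> {a..b} \<and> s \<noteq> t \<and> seg (t, s) \<subseteq> \<gamma> t \<and>
      \<eta> * \<bar>s - t\<bar> < \<bar>F s - F t - f t * (s - t)\<bar>}"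
  have seg_eq: "cball (mid i) (rad i) = seg i" for i
    by (cases i) (auto simp: seg_def mid_def rad_def cball_def dist_real_def min_def max_def abs_if field_simps)
  have cover: "\<exists>i. i \<in> K \<and> t \<in> cball (mid i) (rad i) \<and> rad i < d" if t: "t \<in> ?E" and "0 < d" for t d
  proof -
    have "open (\<gamma> t)" "t \<in> \<gamma> t" using \<gamma> by (auto simp: gauge_def)
    then obtain r where r: "r > 0" "ball t r \<subseteq> \<gamma> t" by (meson open_contains_ball)
    have "min r d > 0" using r \<open>0 < d\<close> by simp
    with t obtain s where s: "s \<in> {a..b}" "s \<noteq> t" "\<bar>s - t\<bar> < min r d"
      "\<eta> * \<bar>s - t\<bar> < \<bar>F s - F t - f t * (s - t)\<bar>" by blast
    have "seg (t, s) \<subseteq> ball t r" using s by (auto simp: seg_def dist_real_def min_def max_def split: if_splits)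
    then have "(t, s) \<in> K" using r s t by (auto simp: K_def)
    moreover have "t \<in> seg (t, s)" "rad (t, s) < d" using s by (auto simp: seg_def rad_def)
    ultimately show ?thesis unfolding seg_eq by blast
  qed
  have "0 < rad i" if "i \<in> K" for i using that by (auto simp: K_def rad_def)
  then obtain C where C: "countable C" "C \<subseteq> K"
    "pairwise (\<lambda>i j. disjnt (cball (mid i) (rad i)) (cball (mid j) (rad j))) C"
    "negligible (?E - (\<Union>i\<in>C. cball (mid i) (rad i)))"
    using Vitali_covering_theorem_cballs[of K rad ?E mid] cover by blast
  have lmeas: "seg i \<in> lmeasurable" for i by (auto simp: seg_def split: prod.split)
  have leb: "measure lebesgue (seg i) = measure lborel (seg i)" for i
    by (simp add: seg_def split: prod.split)
  have fin: "measure lebesgue (\<Union>i\<in>C'. seg i) \<le> e" if C': "C' \<subseteq> C" "finite C'" for C'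
  proof -
    define tag where "tag i = (fst i, seg i)" for i
    have in_K: "i \<in> K" if "i \<in> C'" for i using that C' C by blast
    have disj: "seg i \<inter> seg j = {}" if "i \<in> C'" "j \<in> C'" "i \<noteq> j" for i j
      using C(3) C' that by (auto simp: pairwise_def seg_eq disjnt_def)
    have ne: "fst i \<in> seg i" for i by (cases i) (auto simp: seg_def)
    have inj: "inj_on tag C'"
      by (rule inj_onI) (use disj ne in \<open>fastforce simp: tag_def\<close>)
    have "tag ` C' tagged_partial_division_of (cbox a b)"
      unfolding tagged_partial_division_of_def
    proof (intro conjI allI impI)
      show "finite (tag ` C')" using C' by simp
    next
      fix x k assume "(x, k) \<in> tag ` C'"
      then obtain t s where i: "(t, s) \<in> C'" "x = t" "k = seg (t, s)"
        by (auto simp: tag_def)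
      then show "x \<in> k" "k \<subseteq> cbox a b" "\<exists>a b. k = cbox a b"
        using in_K[OF i(1)] by (auto simp: seg_def K_def cbox_interval)
    next
      fix x1 k1 x2 k2
      assume "(x1, k1) \<in> tag ` C' \<and> (x2, k2) \<in> tag ` C' \<and> (x1, k1) \<noteq> (x2, k2)"
      then obtain i j where "i \<in> C'" "j \<in> C'" "i \<noteq> j" "k1 = seg i" "k2 = seg j"
        by (auto simp: tag_def)
      then show "interior k1 \<inter> interior k2 = {}"
        using disj[of i j] interior_subset[of k1] interior_subset[of k2] by blast
    qed
    moreover have "\<gamma> fine tag ` C'"
      using in_K by (fastforce simp: fine_def tag_def K_def)
    ultimately have "(\<Sum>(x,k)\<in>tag ` C'. norm (measure lborel k *\<^sub>R f x - integral k f)) < e * \<eta>"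
      by (rule Henstock)
    then have small: "(\<Sum>i\<in>C'. \<bar>measure lborel (seg i) * f (fst i) - integral (seg i) f\<bar>) < e * \<eta>"
      by (subst (asm) sum.reindex[OF inj]) (simp add: tag_def)
    have "measure lborel (seg i) * \<eta> \<le> \<bar>measure lborel (seg i) * f (fst i) - integral (seg i) f\<bar>" if iC: "i \<in> C'" for i
    proof -
      obtain t s where i: "i = (t, s)" by (cases i) 
      have ts: "t \<in> {a..b}" "s \<in> {a..b}" "\<eta> * \<bar>s - t\<bar> < \<bar>F s - F t - f t * (s - t)\<bar>"
        using in_K[OF iC] by (auto simp: i K_def)
      show ?thesis
      proof (cases "t \<le> s")
        case True
        then have "integral {t..s} f = F s - F t"
          using ts unfolding F_def by (intro integral_diff_interval[OF f]) auto
        then show ?thesis using ts True by (simp add: i seg_def algebra_simps)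
      next
        case False
        then have "integral {s..t} f = F t - F s"
          using ts unfolding F_def by (intro integral_diff_interval[OF f]) auto
        then show ?thesis using ts False by (simp add: i seg_def algebra_simps)
      qed
    qed
    then have "(\<Sum>i\<in>C'. measure lborel (seg i) * \<eta>) \<le> e * \<eta>"
      using small by (meson less_imp_le order_trans sum_mono)
    then have "(\<Sum>i\<in>C'. measure lborel (seg i)) \<le> e"
      using \<open>\<eta> > 0\<close> by (simp flip: sum_distrib_right)
    moreover have "measure lebesgue (\<Union>i\<in>C'. seg i) \<le> (\<Sum>i\<in>C'. measure lborel (seg i))"
      using measure_UNION_le[OF C'(2), of seg lebesgue] lmeas by (simp add: fmeasurableD leb)
    ultimately show ?thesis by linarith
  qed
  let ?N = "?E - (\<Union>i\<in>C. seg i)"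
  have U: "(\<Union>i\<in>C. seg i) \<in> lmeasurable" "measure lebesgue (\<Union>i\<in>C. seg i) \<le> e"
    using fmeasurable_UN_bound[OF C(1) lmeas fin] measure_UN_bound[OF C(1) lmeas fin] by blast+
  have N: "?N \<in> lmeasurable" "measure lebesgue ?N = 0"
    using C(4) negligible_iff_measure unfolding seg_eq by blast+
  show "\<exists>T. ?E \<subseteq> T \<and> T \<in> lmeasurable \<and> measure lebesgue T \<le> e"
  proof (intro exI conjI)
    show "?E \<subseteq> ?N \<union> (\<Union>i\<in>C. seg i)" by blast
    show "?N \<union> (\<Union>i\<in>C. seg i) \<in> lmeasurable" using U N by (intro fmeasurable.Un)
    show "measure lebesgue (?N \<union> (\<Union>i\<in>C. seg i)) \<le> e"
      using measure_Un_le[of ?N lebesgue "\<Union>i\<in>C. seg i"] U N by (simp add: fmeasurableD)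
  qed
qed

text \<open>Where the derivative is not \<open>f t\<close>, the deviation exceeds a fixed multiple of the length for
intervals of arbitrarily small length, and this multiple can be taken of the form
\<open>1 / (n + 1)\<close>; this leaves countably many negligible sets.\<close>

theorem Lebesgue_differentiation:
  fixes f :: "real \<Rightarrow> real"
  assumes f: "f integrable_on {a..b}"
  shows "negligible {t\<in>{a..b}. \<not> ((\<lambda>s. integral {a..s} f) has_real_derivative f t) (at t within {a..b})}"
    (is "negligible ?N")
proof -
  let ?F = "\<lambda>s. integral {a..s} f"
  define E where "E \<eta> = {t\<in>{a..b}. \<forall>d>0. \<exists>s\<in>{a..b}. s \<noteq> t \<and> \<bar>s - t\<bar> < d \<and>
           \<eta> * \<bar>s - t\<bar> < \<bar>?F s - ?F t - f t * (s - t)\<bar>}" for \<eta>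
  have "negligible (E (1 / real (Suc n)))" for n
    unfolding E_def by (rule negligible_large_difference_quotient[OF f]) simp
  then have "negligible (\<Union>n. E (1 / real (Suc n)))"
    by (intro negligible_countable_Union) auto
  moreover have "?N \<subseteq> (\<Union>n. E (1 / real (Suc n)))"
  proof
    fix t assume "t \<in> ?N"
    then have t: "t \<in> {a..b}" and "\<not> (?F has_derivative (*) (f t)) (at t within {a..b})"
      by (auto simp: has_field_derivative_def)
    then obtain e where e: "e > 0" and "\<not> (\<exists>d>0. \<forall>s\<in>{a..b}. 0 < norm (s - t) \<and> norm (s - t) < d \<longrightarrow>
        norm (?F s - ?F t - f t * (s - t)) / norm (s - t) < e)"
      unfolding has_derivative_within' using bounded_linear_mult_right by blast
    then have far: "\<exists>s\<in>{a..b}. 0 < \<bar>s - t\<bar> \<and> \<bar>s - t\<bar> < d \<and> e \<le> \<bar>?F s - ?F t - f t * (s - t)\<bar> / \<bar>s - t\<bar>"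
      if "d > 0" for d using that by (force simp: not_less)
    obtain n where n: "1 / real (Suc n) < e"
      using e reals_Archimedean[of e] by (auto simp: inverse_eq_divide)
    have "\<exists>s\<in>{a..b}. s \<noteq> t \<and> \<bar>s - t\<bar> < d \<and> 1 / real (Suc n) * \<bar>s - t\<bar> < \<bar>?F s - ?F t - f t * (s - t)\<bar>"
      if d: "d > 0" for d
    proof -
      obtain s where s: "s \<in> {a..b}" "0 < \<bar>s - t\<bar>" "\<bar>s - t\<bar> < d"
        "e \<le> \<bar>?F s - ?F t - f t * (s - t)\<bar> / \<bar>s - t\<bar>"
        using far[OF d] by blast
      have "1 / real (Suc n) * \<bar>s - t\<bar> < e * \<bar>s - t\<bar>"
        using n s(2) by (intro mult_strict_right_mono)
      also have "\<dots> \<le> \<bar>?F s - ?F t - f t * (s - t)\<bar>"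
        using s(2,4) by (simp add: pos_le_divide_eq)
      finally show ?thesis using s by (intro bexI[of _ s]) auto
    qed
    then have "t \<in> E (1 / real (Suc n))" using t by (simp only: E_def mem_Collect_eq) blast
    then show "t \<in> (\<Union>n. E (1 / real (Suc n)))" by blast
  qed
  ultimately show ?thesis by (rule negligible_subset)
qed

section \<open>The fundamental theorem of calculus\<close>

lemma deriv_within_eqI:
  assumes "a < b" "t \<in> {a..b}" "(f has_real_derivative D) (at t within {a..b})"
  shows "deriv_within a b f t = D"
  unfolding deriv_within_def
  using assms by (intro vector_derivative_within_closed_interval)
    (auto simp: has_real_derivative_iff_has_vector_derivative)

text \<open>The density of \<open>h\<close> integrates to \<open>h\<close> up to a constant, and is the derivative of its own
integral almost everywhere. The remaining points, where \<open>deriv_within\<close> may have an arbitrary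
value, form a negligible set.\<close>

theorem abs_cont_on_fundamental_theorem:
  assumes "a < b" and h: "abs_cont_on a b h"
  shows "negligible {t\<in>{a..b}. \<not> (h has_real_derivative deriv_within a b h t) (at t within {a..b})}"
    and "deriv_within a b h absolutely_integrable_on {a..b}"
    and "\<And>s t. \<lbrakk>a \<le> s; s \<le> t; t \<le> b\<rbrakk> \<Longrightarrow> integral {s..t} (deriv_within a b h) = h t - h s"
proof -
  obtain g where g: "g absolutely_integrable_on {a..b}"
    and int: "\<And>s t. \<lbrakk>a \<le> s; s \<le> t; t \<le> b\<rbrakk> \<Longrightarrow> integral {s..t} g = h t - h s"
    using abs_cont_on_density[OF less_imp_le[OF \<open>a < b\<close>] h] by blast
  define N where "N = {t\<in>{a..b}. \<not> ((\<lambda>s. integral {a..s} g) has_real_derivative g t) (at t within {a..b})}"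
  have N: "negligible N"
    unfolding N_def using g by (intro Lebesgue_differentiation set_lebesgue_integral_eq_integral(1))
  have der: "(h has_real_derivative g t) (at t within {a..b})" if t: "t \<in> {a..b} - N" for t
  proof (rule has_field_derivative_transform_within[of _ _ _ _ 1])
    show "((\<lambda>s. integral {a..s} g + h a) has_real_derivative g t) (at t within {a..b})"
      using t by (auto simp: N_def intro!: derivative_eq_intros)
    show "integral {a..s} g + h a = h s" if "s \<in> {a..b}" for s
      using int[of a s] that by simp
  qed (use t in auto)
  have eq: "deriv_within a b h t = g t" if "t \<in> {a..b} - N" for t
    using deriv_within_eqI[OF \<open>a < b\<close> _ der[OF that]] that by simp
  show "negligible {t\<in>{a..b}. \<not> (h has_real_derivative deriv_within a b h t) (at t within {a..b})}"
    by (rule negligible_subset[OF N]) (use der eq in force)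
  show "deriv_within a b h absolutely_integrable_on {a..b}"
    by (rule absolutely_integrable_spike[OF g N]) (rule eq)
  show "integral {s..t} (deriv_within a b h) = h t - h s" if "a \<le> s" "s \<le> t" "t \<le> b" for s t
    using integral_spike[OF N, of "{s..t}" g "deriv_within a b h"] eq int[OF that] that by auto
qed

lemma sum_integral_short_family_le:
  fixes H :: "real \<Rightarrow> real"
  assumes H: "H integrable_on {a..b}" and nonneg: "\<And>t. t \<in> {a..b} \<Longrightarrow> H t \<ge> 0"
    and I: "short_family a b \<delta> I"
  shows "(\<Sum>(u, v)\<in>I. integral {u..v} H) \<le> integral {a..b} H"
proof -
  define seg where "seg = (\<lambda>(u, v). {u..v::real})"
  have I': "finite I" "\<And>u v. (u, v) \<in> I \<Longrightarrow> a \<le> u \<and> u < v \<and> v \<le> b"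
    and disj: "\<And>u v u' v'. \<lbrakk>(u, v) \<in> I; (u', v') \<in> I; (u, v) \<noteq> (u', v')\<rbrakk> \<Longrightarrow> {u<..<v} \<inter> {u'<..<v'} = {}"
    using I unfolding short_family_def pairwise_def by blast+
  have inj: "inj_on seg I"
    by (rule inj_onI) (use I'(2) in \<open>force simp: seg_def Icc_eq_Icc\<close>)
  have div: "seg ` I division_of \<Union>(seg ` I)"
    unfolding division_of_def
  proof (intro conjI ballI impI)
    fix k assume "k \<in> seg ` I"
    then show "k \<noteq> {}" "\<exists>a b. k = cbox a b" using I'(2) by (fastforce simp: seg_def cbox_interval)+
  next
    fix k1 k2 assume k: "k1 \<in> seg ` I" "k2 \<in> seg ` I" "k1 \<noteq> k2"
    then obtain u v u' v' where "(u, v) \<in> I" "(u', v') \<in> I" "k1 = {u..v}" "k2 = {u'..v'}"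
      by (auto simp: seg_def)
    then show "interior k1 \<inter> interior k2 = {}"
      using disj[of u v u' v'] k(3) by auto
  qed (use I' in auto)
  have sub: "\<Union>(seg ` I) \<subseteq> {a..b}" using I'(2) by (fastforce simp: seg_def)
  have intU: "H integrable_on \<Union>(seg ` I)" by (rule integrable_on_subdivision[OF div H sub])
  have "(\<Sum>(u, v)\<in>I. integral {u..v} H) = (\<Sum>k\<in>seg ` I. integral k H)"
    by (subst sum.reindex[OF inj]) (auto simp: seg_def intro!: sum.cong)
  also have "\<dots> = integral (\<Union>(seg ` I)) H"
    by (rule integral_combine_division_topdown[OF intU div, symmetric])
  also have "\<dots> \<le> integral {a..b} H"
    using nonneg by (intro integral_subset_le[OF sub intU H]) auto
  finally show ?thesis .
qed

text \<open>Cut \<open>\<bar>g\<bar>\<close> at height \<open>n\<close>. The part below contributes at most \<open>n\<close> times the total length of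
the family. The excess \<open>T n\<close> contributes at most its integral over the whole interval, which
tends to zero by dominated convergence. So one chooses \<open>n\<close> first and \<open>\<delta>\<close> afterwards.\<close>

lemma abs_cont_on_indefinite_integral:
  fixes g :: "real \<Rightarrow> real"
  assumes g: "g absolutely_integrable_on {a..b}"
  shows "abs_cont_on a b (\<lambda>t. integral {a..t} g)"
  unfolding abs_cont_on_iff
proof (intro allI impI)
  fix \<epsilon> :: real assume "\<epsilon> > 0"
  define T where "T n t = max (\<bar>g t\<bar> - real n) 0" for n t
  have abs_g: "(\<lambda>t. \<bar>g t\<bar>) absolutely_integrable_on {a..b}"
    using absolutely_integrable_norm[OF g] by (simp add: comp_def)
  have const: "(\<lambda>_. c) absolutely_integrable_on {a..b}" for c :: real
    by (intro absolutely_integrable_continuous_real continuous_intros)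
  have le_T: "\<bar>g t\<bar> \<le> real n + T n t" for n t by (simp add: T_def)
  have T_abs: "T n absolutely_integrable_on {a..b}" for n
    unfolding T_def
    by (intro absolutely_integrable_max_1 set_integral_diff(1) abs_g const)
  have T_int: "T n integrable_on {a..b}" for n
    using T_abs by (rule set_lebesgue_integral_eq_integral(1))
  have "(\<lambda>n. integral {a..b} (T n)) \<longlonglongrightarrow> integral {a..b} (\<lambda>t. 0)"
  proof (rule dominated_convergence(2)[OF T_int])
    show "(\<lambda>t. \<bar>g t\<bar>) integrable_on {a..b}" using abs_g by (rule set_lebesgue_integral_eq_integral(1))
    show "norm (T n t) \<le> \<bar>g t\<bar>" for n t by (auto simp: T_def)
    show "(\<lambda>n. T n t) \<longlonglongrightarrow> 0" for t
    proof (rule tendsto_eventually)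
      obtain m where "\<bar>g t\<bar> \<le> real m" using real_arch_simple by blast
      then show "\<forall>\<^sub>F n in sequentially. T n t = 0"
        by (intro eventually_sequentiallyI[of m]) (auto simp: T_def)
    qed
  qed
  then have "\<forall>\<^sub>F n in sequentially. integral {a..b} (T n) < \<epsilon> / 2"
    using \<open>\<epsilon> > 0\<close> by (intro order_tendstoD(2)[where y = "integral {a..b} (\<lambda>t. 0)"]) simp_all
  then obtain n where n: "integral {a..b} (T n) < \<epsilon> / 2"
    by (auto simp: eventually_sequentially)
  define \<delta> where "\<delta> = \<epsilon> / (2 * (real n + 1))"
  have "\<delta> > 0" using \<open>\<epsilon> > 0\<close> by (simp add: \<delta>_def)
  have n\<delta>: "real n * \<delta> \<le> \<epsilon> / 2"
    using \<open>\<epsilon> > 0\<close> by (simp add: \<delta>_def field_simps)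
  have "(\<Sum>(u, v)\<in>I. \<bar>integral {a..v} g - integral {a..u} g\<bar>) < \<epsilon>" if I: "short_family a b \<delta> I" for I
  proof -
    have step: "\<bar>integral {a..v} g - integral {a..u} g\<bar> \<le> real n * (v - u) + integral {u..v} (T n)"
      if uv: "(u, v) \<in> I" for u v
    proof -
      have bd: "a \<le> u" "u \<le> v" "v \<le> b" using short_family_bounds[OF I uv] .
      have int: "T n integrable_on {u..v}" "g integrable_on {u..v}"
        using abs_integrable_subinterval(2)[OF T_abs] abs_integrable_subinterval(2)[OF g] bd by auto
      have "integral {a..v} g - integral {a..u} g = integral {u..v} g"
        using integral_diff_interval[OF set_lebesgue_integral_eq_integral(1)[OF g] bd] by simp
      also have "norm \<dots> \<le> integral {u..v} (\<lambda>t. real n + T n t)"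
        using int le_T by (intro integral_norm_bound_integral integrable_add) auto
      also have "\<dots> = real n * (v - u) + integral {u..v} (T n)"
        using int bd by (subst integral_add) auto
      finally show ?thesis by simp
    qed
    have "(\<Sum>(u, v)\<in>I. \<bar>integral {a..v} g - integral {a..u} g\<bar>)
        \<le> (\<Sum>(u, v)\<in>I. real n * (v - u) + integral {u..v} (T n))"
      using step by (intro sum_mono) auto
    also have "\<dots> = real n * (\<Sum>(u, v)\<in>I. v - u) + (\<Sum>(u, v)\<in>I. integral {u..v} (T n))"
      by (simp add: sum.distrib sum_distrib_left case_prod_unfold)
    also have "\<dots> \<le> real n * \<delta> + integral {a..b} (T n)"
      using I sum_integral_short_family_le[OF T_int _ I, of n]
      by (intro add_mono mult_left_mono) (auto simp: T_def short_family_def)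
    also have "\<dots> < \<epsilon>" using n n\<delta> by linarith
    finally show ?thesis .
  qed
  then show "\<exists>\<delta>>0. \<forall>I. short_family a b \<delta> I \<longrightarrow>
      (\<Sum>(u, v)\<in>I. \<bar>integral {a..v} g - integral {a..u} g\<bar>) < \<epsilon>"
    using \<open>\<delta> > 0\<close> by blast
qed

section \<open>Integration by parts\<close>

lemma absolutely_integrable_continuous_mult:
  fixes f g :: "real \<Rightarrow> real"
  assumes f: "continuous_on {a..b} f" and g: "g absolutely_integrable_on {a..b}"
  shows "(\<lambda>t. f t * g t) absolutely_integrable_on {a..b}"
proof (rule absolutely_integrable_bounded_measurable_product_real[OF _ _ _ g])
  show "f \<in> borel_measurable (lebesgue_on {a..b})"
    using f by (intro continuous_imp_measurable_on_sets_lebesgue) auto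
  show "bounded (f ` {a..b})"
    using f by (intro compact_imp_bounded compact_continuous_image) auto
qed auto

text \<open>The product of \<open>U\<close> and \<open>h\<close> is absolutely continuous, and the product rule holds almost
everywhere. The constant \<open>C\<close> makes the lemma apply both to the antiderivative of \<open>u\<close> that
vanishes at \<open>a\<close> and to the one that vanishes at \<open>b\<close>.\<close>

lemma integration_by_parts_abs_cont:
  assumes "a < b" and u: "u absolutely_integrable_on {a..b}" and h: "abs_cont_on a b h"
    and U: "\<And>t. t \<in> {a..b} \<Longrightarrow> U t = C + integral {a..t} u"
    and "a \<le> c" "c \<le> d" "d \<le> b"
  shows "integral {c..d} (\<lambda>t. u t * h t) + integral {c..d} (\<lambda>t. U t * deriv_within a b h t)
    = U d * h d - U c * h c"
proof -
  let ?h' = "deriv_within a b h"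
  have U_ac: "abs_cont_on a b U"
    by (rule abs_cont_on_cong[OF abs_cont_on_add[OF abs_cont_on_const
          abs_cont_on_indefinite_integral[OF u]]]) (simp add: U)
  define P where "P t = U t * h t" for t
  have P: "abs_cont_on a b P"
    unfolding P_def by (rule abs_cont_on_mult[OF U_ac h])
  define N1 where "N1 = {t\<in>{a..b}. \<not> ((\<lambda>s. integral {a..s} u) has_real_derivative u t) (at t within {a..b})}"
  define N2 where "N2 = {t\<in>{a..b}. \<not> (h has_real_derivative ?h' t) (at t within {a..b})}"
  have N: "negligible (N1 \<union> N2)"
    unfolding N1_def N2_def
    using Lebesgue_differentiation[OF set_lebesgue_integral_eq_integral(1)[OF u]]
      abs_cont_on_fundamental_theorem(1)[OF \<open>a < b\<close> h] by (rule negligible_Un)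
  have eq: "deriv_within a b P t = u t * h t + U t * ?h' t" if t: "t \<in> {a..b} - (N1 \<union> N2)" for t
  proof (rule deriv_within_eqI[OF \<open>a < b\<close>])
    have "(U has_real_derivative u t) (at t within {a..b})"
    proof (rule has_field_derivative_transform_within[of _ _ _ _ 1])
      show "((\<lambda>s. C + integral {a..s} u) has_real_derivative u t) (at t within {a..b})"
        using t by (auto simp: N1_def intro!: derivative_eq_intros)
    qed (use t U in auto)
    then show "(P has_real_derivative u t * h t + U t * ?h' t) (at t within {a..b})"
      unfolding P_def using t by (auto simp: N2_def intro!: derivative_eq_intros)
  qed (use t in auto)
  have uh: "(\<lambda>t. u t * h t) absolutely_integrable_on {a..b}"
    using absolutely_integrable_continuous_mult[OF abs_cont_on_continuous[OF h] u]
    by (simp add: mult.commute)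
  have Uh: "(\<lambda>t. U t * ?h' t) absolutely_integrable_on {a..b}"
    by (rule absolutely_integrable_continuous_mult[OF abs_cont_on_continuous[OF U_ac]
          abs_cont_on_fundamental_theorem(2)[OF \<open>a < b\<close> h]])
  have "integral {c..d} (\<lambda>t. u t * h t) + integral {c..d} (\<lambda>t. U t * ?h' t)
      = integral {c..d} (\<lambda>t. u t * h t + U t * ?h' t)"
    using abs_integrable_subinterval(2)[OF uh] abs_integrable_subinterval(2)[OF Uh] assms
    by (subst integral_add) auto
  also have "\<dots> = integral {c..d} (deriv_within a b P)"
    using eq assms by (intro integral_spike[OF N]) auto
  also have "\<dots> = P d - P c"
    using assms by (intro abs_cont_on_fundamental_theorem(3)[OF \<open>a < b\<close> P])
  finally show ?thesis by (simp add: P_def)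
qed

lemma r_op_eq:
  assumes u: "u absolutely_integrable_on {a..b}" and "x \<in> {a..b}" and s: "s \<in> {a..b}"
  shows "r_op a b x u s = (if s \<le> x then - integral {a..s} u else integral {a..b} u - integral {a..s} u)"
proof -
  have "(LINT t:{a..s}|lebesgue. u t) = integral {a..s} u"
    using s by (intro set_lebesgue_integral_eq_integral(2) abs_integrable_subinterval(1)[OF u]) auto
  moreover have "(LINT t:{s..b}|lebesgue. u t) = integral {s..b} u"
    using s by (intro set_lebesgue_integral_eq_integral(2) abs_integrable_subinterval(1)[OF u]) auto
  moreover have "integral {s..b} u = integral {a..b} u - integral {a..s} u"
    using s by (intro integral_diff_interval[OF set_lebesgue_integral_eq_integral(1)[OF u]]) auto
  ultimately show ?thesis by (simp add: r_op_def)
qed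

lemma r_op_measurable_bounded:
  assumes u: "u absolutely_integrable_on {a..b}" and x: "x \<in> {a..b}"
  shows "r_op a b x u \<in> borel_measurable (lebesgue_on {a..b})" "bounded (r_op a b x u ` {a..b})"
proof -
  define U where "U s = integral {a..s} u" for s
  have cont: "continuous_on {a..b} U"
    unfolding U_def by (intro indefinite_integral_continuous_1 set_lebesgue_integral_eq_integral(1)[OF u])
  have [measurable]: "U \<in> borel_measurable (lebesgue_on {a..b})"
    using cont by (intro continuous_imp_measurable_on_sets_lebesgue) auto
  have [measurable]: "(\<lambda>s. s) \<in> borel_measurable (lebesgue_on {a..b})"
    by (intro continuous_imp_measurable_on_sets_lebesgue continuous_intros) auto
  have "(\<lambda>s. if s \<le> x then - U s else c - U s) \<in> borel_measurable (lebesgue_on {a..b})" for c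
    by measurable
  from this[of "U b"] show "r_op a b x u \<in> borel_measurable (lebesgue_on {a..b})"
    by (rule measurable_cong[THEN iffD2, rotated]) (simp add: r_op_eq[OF u x] U_def)
  have "bounded (U ` {a..b})" using cont by (intro compact_imp_bounded compact_continuous_image) auto
  then obtain B where B: "\<And>s. s \<in> {a..b} \<Longrightarrow> \<bar>U s\<bar> \<le> B"
    unfolding bounded_iff by (metis imageI real_norm_def)
  have "\<bar>r_op a b x u s\<bar> \<le> B + B" if "s \<in> {a..b}" for s
    using B[OF that] B[of b] x that by (auto simp: r_op_eq[OF u x that] U_def[symmetric])
  then show "bounded (r_op a b x u ` {a..b})"
    unfolding bounded_iff by (intro exI[of _ "B + B"]) auto
qed

lemma r_op_absolutely_integrable:
  assumes u: "u absolutely_integrable_on {a..b}" and x: "x \<in> {a..b}"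
  shows "r_op a b x u absolutely_integrable_on {a..b}"
proof -
  have "(\<lambda>_. 1 :: real) absolutely_integrable_on {a..b}"
    by (intro absolutely_integrable_continuous_real continuous_intros)
  from absolutely_integrable_bounded_measurable_product_real[OF r_op_measurable_bounded(1)[OF u x] _
      r_op_measurable_bounded(2)[OF u x] this]
  show ?thesis by simp
qed

text \<open>To the left of \<open>x\<close> integrate by parts with the antiderivative of \<open>u\<close> that vanishes at
\<open>a\<close>, to the right with the one that vanishes at \<open>b\<close>. Both are \<open>r_op\<close> up to the sign, and
the boundary terms at \<open>x\<close> add up to \<open>h x\<close> times the integral of \<open>u\<close>.\<close>

lemma integral_mult_abs_cont:
  assumes "a < b" and u: "u absolutely_integrable_on {a..b}" and h: "abs_cont_on a b h"
    and x: "x \<in> {a..b}"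
  shows "integral {a..b} (\<lambda>t. u t * h t)
    = h x * integral {a..b} u + integral {a..b} (\<lambda>t. r_op a b x u t * deriv_within a b h t)"
proof -
  let ?h' = "deriv_within a b h" and ?r = "r_op a b x u"
  define U where "U t = integral {a..t} u" for t
  define V where "V t = - U b + U t" for t
  have ax: "a \<le> x" "x \<le> b" using x by auto
  have uh: "(\<lambda>t. u t * h t) absolutely_integrable_on {a..b}"
    using absolutely_integrable_continuous_mult[OF abs_cont_on_continuous[OF h] u]
    by (simp add: mult.commute)
  have rh: "(\<lambda>t. ?r t * ?h' t) absolutely_integrable_on {a..b}"
    by (intro absolutely_integrable_bounded_measurable_product_real r_op_measurable_bounded[OF u x]
        abs_cont_on_fundamental_theorem(2)[OF \<open>a < b\<close> h]) auto
  have "integral {a..x} (\<lambda>t. u t * h t) + integral {a..x} (\<lambda>t. U t * ?h' t) = U x * h x - U a * h a"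
    using ax by (intro integration_by_parts_abs_cont[OF \<open>a < b\<close> u h, where C=0]) (auto simp: U_def)
  moreover have "integral {a..x} (\<lambda>t. U t * ?h' t) = - integral {a..x} (\<lambda>t. ?r t * ?h' t)"
    unfolding integral_neg[symmetric]
    using ax by (intro integral_cong) (simp add: r_op_eq[OF u x] U_def)
  moreover have "integral {x..b} (\<lambda>t. u t * h t) + integral {x..b} (\<lambda>t. V t * ?h' t) = V b * h b - V x * h x"
    using ax by (intro integration_by_parts_abs_cont[OF \<open>a < b\<close> u h, where C="- U b"]) (auto simp: U_def V_def)
  moreover have "integral {x..b} (\<lambda>t. V t * ?h' t) = - integral {x..b} (\<lambda>t. ?r t * ?h' t)"
    unfolding integral_neg[symmetric]
  proof (rule integral_spike)
    \<comment> \<open>At \<open>x\<close> itself, \<open>r_op\<close> takes the value of its left branch.\<close>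
    show "negligible {x}" by simp
    show "- (?r t * ?h' t) = V t * ?h' t" if "t \<in> {x..b} - {x}" for t
      using that ax by (simp add: r_op_eq[OF u x] U_def V_def algebra_simps)
  qed
  moreover have "integral {a..b} (\<lambda>t. u t * h t) = integral {a..x} (\<lambda>t. u t * h t) + integral {x..b} (\<lambda>t. u t * h t)"
    using Henstock_Kurzweil_Integration.integral_combine[OF ax set_lebesgue_integral_eq_integral(1)[OF uh]] by simp
  moreover have "integral {a..b} (\<lambda>t. ?r t * ?h' t)
      = integral {a..x} (\<lambda>t. ?r t * ?h' t) + integral {x..b} (\<lambda>t. ?r t * ?h' t)"
    using Henstock_Kurzweil_Integration.integral_combine[OF ax set_lebesgue_integral_eq_integral(1)[OF rh]] by simp
  ultimately show ?thesis
    by (simp add: V_def U_def algebra_simps)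
qed

section \<open>Functions with an absolutely continuous derivative\<close>

lemma deriv_within_cong:
  assumes "\<And>s. s \<in> {a..b} \<Longrightarrow> f s = g s" "t \<in> {a..b}"
  shows "deriv_within a b f t = deriv_within a b g t"
proof -
  have "(f has_vector_derivative D) (at t within {a..b}) \<longleftrightarrow> (g has_vector_derivative D) (at t within {a..b})" for D
    using has_vector_derivative_transform[OF assms(2), of g f] has_vector_derivative_transform[OF assms(2), of f g]
      assms(1) by auto
  then show ?thesis by (simp add: deriv_within_def vector_derivative_def)
qed

lemma has_abs_cont_deriv_0: "has_abs_cont_deriv a b 0 f \<longleftrightarrow> abs_cont_on a b f"
  by (simp add: has_abs_cont_deriv_def iter_deriv_def)

text \<open>The recursion takes off the first derivative rather than the last one, so that the closure
properties below can be proved by induction on the order, with the functions arbitrary.\<close>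

lemma has_abs_cont_deriv_Suc:
  "has_abs_cont_deriv a b (Suc m) f \<longleftrightarrow>
     f differentiable_on {a..b} \<and> has_abs_cont_deriv a b m (deriv_within a b f)"
proof -
  have "iter_deriv a b (Suc j) f = iter_deriv a b j (deriv_within a b f)" for j
    by (simp add: iter_deriv_def funpow_Suc_right del: funpow.simps)
  moreover have "iter_deriv a b 0 f = f" by (simp add: iter_deriv_def)
  ultimately show ?thesis
    unfolding has_abs_cont_deriv_def All_less_Suc2 by (auto simp del: One_nat_def)
qed

lemma has_abs_cont_deriv_cong:
  assumes "has_abs_cont_deriv a b m f" "\<And>t. t \<in> {a..b} \<Longrightarrow> f t = g t"
  shows "has_abs_cont_deriv a b m g"
  using assms
proof (induction m arbitrary: f g)
  case 0
  then show ?case by (auto simp: has_abs_cont_deriv_0 intro: abs_cont_on_cong)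
next
  case (Suc m)
  have "g differentiable_on {a..b}"
    unfolding differentiable_on_def
  proof
    fix t assume t: "t \<in> {a..b}"
    then have "f differentiable at t within {a..b}"
      using Suc.prems(1) by (simp add: has_abs_cont_deriv_Suc differentiable_on_def)
    then show "g differentiable at t within {a..b}"
      by (rule differentiable_transform_within[of _ _ _ 1]) (use t Suc.prems(2) in auto)
  qed
  moreover have "has_abs_cont_deriv a b m (deriv_within a b g)"
  proof (rule Suc.IH)
    show "has_abs_cont_deriv a b m (deriv_within a b f)"
      using Suc.prems(1) by (simp add: has_abs_cont_deriv_Suc)
    show "deriv_within a b f t = deriv_within a b g t" if "t \<in> {a..b}" for t
      by (rule deriv_within_cong[OF Suc.prems(2) that])
  qed
  ultimately show ?case by (simp add: has_abs_cont_deriv_Suc)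
qed

lemma has_abs_cont_deriv_derivative:
  assumes "has_abs_cont_deriv a b (Suc m) f" "t \<in> {a..b}"
  shows "(f has_real_derivative deriv_within a b f t) (at t within {a..b})"
proof -
  have "f differentiable at t within {a..b}"
    using assms by (auto simp: has_abs_cont_deriv_Suc differentiable_on_def)
  then show ?thesis
    by (simp add: deriv_within_def has_real_derivative_iff_has_vector_derivative vector_derivative_works)
qed

lemma has_abs_cont_deriv_SucI:
  assumes "a < b" "\<And>t. t \<in> {a..b} \<Longrightarrow> (f has_real_derivative f' t) (at t within {a..b})"
    and "has_abs_cont_deriv a b m f'"
  shows "has_abs_cont_deriv a b (Suc m) f"
  unfolding has_abs_cont_deriv_Suc
proof
  show "f differentiable_on {a..b}"
    using assms(2) by (force simp: differentiable_on_def differentiable_def has_field_derivative_def)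
  show "has_abs_cont_deriv a b m (deriv_within a b f)"
    by (rule has_abs_cont_deriv_cong[OF assms(3)]) (simp add: deriv_within_eqI[OF assms(1) _ assms(2)])
qed

text \<open>At order zero, the derivative is absolutely continuous and hence bounded, so the function is
Lipschitz continuous.\<close>

lemma has_abs_cont_deriv_lower:
  assumes "a < b" "has_abs_cont_deriv a b (Suc m) f"
  shows "has_abs_cont_deriv a b m f"
  using assms(2)
proof (induction m arbitrary: f)
  case 0
  note der = has_abs_cont_deriv_derivative[OF 0]
  have "abs_cont_on a b (deriv_within a b f)"
    using 0 by (simp add: has_abs_cont_deriv_Suc has_abs_cont_deriv_0)
  then obtain B where B: "B \<ge> 0" "\<And>t. t \<in> {a..b} \<Longrightarrow> \<bar>deriv_within a b f t\<bar> \<le> B"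
    using abs_cont_on_bounded by blast
  have "abs_cont_on a b f"
  proof (rule abs_cont_on_Lipschitz[OF B(1)])
    show "\<bar>f t - f s\<bar> \<le> B * (t - s)" if "a \<le> s" "s \<le> t" "t \<le> b" for s t
      using field_differentiable_bound[of "{a..b}" f "deriv_within a b f" B t s] der B(2) that by auto
  qed
  then show ?case by (simp add: has_abs_cont_deriv_0)
next
  case (Suc m)
  show ?case
    using Suc.IH[of "deriv_within a b f"] Suc.prems
    by (intro has_abs_cont_deriv_SucI[OF \<open>a < b\<close> has_abs_cont_deriv_derivative[OF Suc.prems]])
      (auto simp: has_abs_cont_deriv_Suc)
qed

lemma has_abs_cont_deriv_abs_cont:
  assumes "a < b" "has_abs_cont_deriv a b m f"
  shows "abs_cont_on a b f"
  using assms(2)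
proof (induction m)
  case (Suc m)
  then show ?case using has_abs_cont_deriv_lower[OF assms(1)] by blast
qed (simp add: has_abs_cont_deriv_0)

lemma has_abs_cont_deriv_const:
  assumes "a < b"
  shows "has_abs_cont_deriv a b m (\<lambda>t. c)"
proof (induction m arbitrary: c)
  case (Suc m)
  show ?case by (rule has_abs_cont_deriv_SucI[OF assms _ Suc.IH[of 0]]) (rule DERIV_const)
qed (simp add: has_abs_cont_deriv_0 abs_cont_on_const)

lemma has_abs_cont_deriv_add:
  assumes "a < b" "has_abs_cont_deriv a b m f" "has_abs_cont_deriv a b m g"
  shows "has_abs_cont_deriv a b m (\<lambda>t. f t + g t)"
  using assms(2,3)
proof (induction m arbitrary: f g)
  case (Suc m)
  show ?case
  proof (rule has_abs_cont_deriv_SucI[OF assms(1)])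
    show "((\<lambda>t. f t + g t) has_real_derivative deriv_within a b f t + deriv_within a b g t)
        (at t within {a..b})" if "t \<in> {a..b}" for t
      using that by (intro DERIV_add has_abs_cont_deriv_derivative[OF Suc.prems(1)]
          has_abs_cont_deriv_derivative[OF Suc.prems(2)])
    show "has_abs_cont_deriv a b m (\<lambda>t. deriv_within a b f t + deriv_within a b g t)"
      using Suc.prems by (intro Suc.IH) (auto simp: has_abs_cont_deriv_Suc)
  qed
qed (simp add: has_abs_cont_deriv_0 abs_cont_on_add)

lemma has_abs_cont_deriv_mult:
  assumes "a < b" "has_abs_cont_deriv a b m f" "has_abs_cont_deriv a b m g"
  shows "has_abs_cont_deriv a b m (\<lambda>t. f t * g t)"
  using assms(2,3)
proof (induction m arbitrary: f g)
  case (Suc m)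
  show ?case
  proof (rule has_abs_cont_deriv_SucI[OF assms(1)])
    show "((\<lambda>t. f t * g t) has_real_derivative deriv_within a b f t * g t + deriv_within a b g t * f t)
        (at t within {a..b})" if "t \<in> {a..b}" for t
      using that by (intro DERIV_mult has_abs_cont_deriv_derivative[OF Suc.prems(1)]
          has_abs_cont_deriv_derivative[OF Suc.prems(2)])
    show "has_abs_cont_deriv a b m (\<lambda>t. deriv_within a b f t * g t + deriv_within a b g t * f t)"
      using Suc.prems has_abs_cont_deriv_lower[OF assms(1)]
      by (intro has_abs_cont_deriv_add[OF assms(1)] Suc.IH) (auto simp: has_abs_cont_deriv_Suc)
  qed
qed (simp add: has_abs_cont_deriv_0 abs_cont_on_mult)

text \<open>The derivative of \<open>1 / f\<close> is the product of \<open>-f'\<close> with the square of \<open>1 / f\<close>, where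
\<open>1 / f\<close> enters with one order less: the induction hypothesis and closure under products
suffice.\<close>

lemma has_abs_cont_deriv_inverse:
  assumes "a < b" "has_abs_cont_deriv a b m f" and pos: "\<And>t. t \<in> {a..b} \<Longrightarrow> f t > 0"
  shows "has_abs_cont_deriv a b m (\<lambda>t. 1 / f t)"
  using assms(2)
proof (induction m)
  case 0
  then show ?case
    unfolding has_abs_cont_deriv_0 by (rule abs_cont_on_inverse) (rule pos)
next
  case (Suc m)
  have inv: "has_abs_cont_deriv a b m (\<lambda>t. 1 / f t)"
    by (rule Suc.IH[OF has_abs_cont_deriv_lower[OF assms(1) Suc.prems]])
  show ?case
  proof (rule has_abs_cont_deriv_SucI[OF assms(1)])
    show "((\<lambda>t. 1 / f t) has_real_derivative - 1 * deriv_within a b f t * ((1 / f t) * (1 / f t)))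
        (at t within {a..b})" if "t \<in> {a..b}" for t
      using pos[OF that]
      by (auto intro!: derivative_eq_intros has_abs_cont_deriv_derivative[OF Suc.prems that])
    show "has_abs_cont_deriv a b m (\<lambda>t. - 1 * deriv_within a b f t * ((1 / f t) * (1 / f t)))"
      using Suc.prems inv assms(1)
      by (intro has_abs_cont_deriv_mult has_abs_cont_deriv_const) (auto simp: has_abs_cont_deriv_Suc)
  qed
qed

lemma has_real_derivative_integral_continuous:
  assumes "continuous_on {a..b} g" "t \<in> {a..b}"
  shows "((\<lambda>s. integral {a..s} g) has_real_derivative g t) (at t within {a..b})"
  using integral_has_vector_derivative[OF assms]
  by (simp add: has_real_derivative_iff_has_vector_derivative)

lemma has_abs_cont_deriv_integral:
  assumes "a < b" "has_abs_cont_deriv a b m g"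
  shows "has_abs_cont_deriv a b (Suc m) (\<lambda>t. integral {a..t} g)"
  using has_real_derivative_integral_continuous[OF abs_cont_on_continuous[OF
        has_abs_cont_deriv_abs_cont[OF assms]]]
  by (intro has_abs_cont_deriv_SucI[OF assms(1) _ assms(2)]) auto

section \<open>The remainder formula\<close>

text \<open>These functions undo the operators one at a time, starting from \<open>g\<close> in the role of
\<open>D\<^sub>n f\<close>: after \<open>j\<close> steps one has a candidate for \<open>D\<^sub>n\<^sub>-\<^sub>j f\<close>, and after \<open>n\<close> steps a
candidate for \<open>f\<close>.\<close>

primrec nested_integral ::
    "real \<Rightarrow> (nat \<Rightarrow> real \<Rightarrow> real) \<Rightarrow> nat \<Rightarrow> (real \<Rightarrow> real) \<Rightarrow> nat \<Rightarrow> real \<Rightarrow> real" where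
  "nested_integral a w n g 0 = g"
| "nested_integral a w n g (Suc j) = (\<lambda>t. w (n - j) t * integral {a..t} (nested_integral a w n g j))"

context
  fixes a b :: real and n :: nat and w :: "nat \<Rightarrow> real \<Rightarrow> real"
  assumes ab: "a < b"
    and w_pos: "\<And>k t. k \<in> {1..n} \<Longrightarrow> t \<in> {a..b} \<Longrightarrow> w k t > 0"
    and w_smooth: "\<And>k. k \<in> {1..n} \<Longrightarrow> has_abs_cont_deriv a b (n - k) (w k)"
begin

lemma weight_continuous: "k \<in> {1..n} \<Longrightarrow> continuous_on {a..b} (w k)"
  using abs_cont_on_continuous[OF has_abs_cont_deriv_abs_cont[OF ab w_smooth]] .

text \<open>Each operator costs one order of smoothness, and the hypotheses on the weights are graded so
that \<open>w\<^sub>k\<^sub>+\<^sub>1\<close> is just as smooth as the quotient is required to be. At \<open>k = n - 1\<close> what is left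
is absolute continuity.\<close>

lemma D_op_quotient_regular:
  assumes f: "has_abs_cont_deriv a b (n - 1) f" and "k < n"
  shows "has_abs_cont_deriv a b (n - Suc k) (\<lambda>t. 1 / w (Suc k) t * D_op a b w k f t)"
  using \<open>k < n\<close>
proof (induction k)
  case 0
  then show ?case
    using f by (intro has_abs_cont_deriv_mult[OF ab] has_abs_cont_deriv_inverse[OF ab]) (auto intro: w_smooth w_pos)
next
  case (Suc k)
  have "n - Suc k = Suc (n - Suc (Suc k))" using Suc.prems by simp
  then have "has_abs_cont_deriv a b (n - Suc (Suc k)) (D_op a b w (Suc k) f)"
    using Suc by (simp add: has_abs_cont_deriv_Suc)
  then show ?case
    using Suc.prems
    by (intro has_abs_cont_deriv_mult[OF ab] has_abs_cont_deriv_inverse[OF ab]) (auto intro: w_smooth w_pos)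
qed

lemma r_iter_absolutely_integrable:
  assumes p: "p absolutely_integrable_on {a..b}" and x: "x \<in> {a..b}" and "k \<le> n"
  shows "r_iter a b x w p k absolutely_integrable_on {a..b}"
  using \<open>k \<le> n\<close>
proof (induction k)
  case (Suc k)
  then show ?case
    by (simp, intro r_op_absolutely_integrable[OF _ x] absolutely_integrable_continuous_mult weight_continuous) auto
qed (simp add: p)

lemma weighted_r_iter_absolutely_integrable:
  assumes p: "p absolutely_integrable_on {a..b}" and x: "x \<in> {a..b}" and "k < n"
  shows "(\<lambda>t. w (Suc k) t * r_iter a b x w p k t) absolutely_integrable_on {a..b}"
  using \<open>k < n\<close>
  by (intro absolutely_integrable_continuous_mult weight_continuous r_iter_absolutely_integrable[OF p x]) auto

text \<open>The function \<open>p\<close> may be unbounded, but every later kernel is an indefinite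
integral with one jump.\<close>

lemma r_iter_measurable_bounded:
  assumes p: "p absolutely_integrable_on {a..b}" and x: "x \<in> {a..b}" and "n \<ge> 1"
  shows "r_iter a b x w p n \<in> borel_measurable (lebesgue_on {a..b})"
    "bounded (r_iter a b x w p n ` {a..b})"
proof -
  obtain k where n: "n = Suc k" using \<open>n \<ge> 1\<close> by (cases n) auto
  have k: "k < n" using n by simp
  note wr = weighted_r_iter_absolutely_integrable[OF p x k]
  have "r_iter a b x w p n = r_op a b x (\<lambda>t. w (Suc k) t * r_iter a b x w p k t)"
    by (simp add: n)
  then show "r_iter a b x w p n \<in> borel_measurable (lebesgue_on {a..b})"
    "bounded (r_iter a b x w p n ` {a..b})"
    using r_op_measurable_bounded[OF wr x] by simp_all
qed

text \<open>Here \<open>u\<close> and \<open>h\<close> share the weight: it cancels in their product, \<open>r_op\<close> turns \<open>u\<close>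
into the next kernel, and the derivative of \<open>h\<close> is by definition the next operator.\<close>

lemma remainder_step:
  assumes p: "p absolutely_integrable_on {a..b}" and x: "x \<in> {a..b}"
    and f: "has_abs_cont_deriv a b (n - 1) f" and "k < n"
  shows "integral {a..b} (\<lambda>t. r_iter a b x w p k t * D_op a b w k f t)
    = integral {a..b} (\<lambda>t. r_iter a b x w p k t * w (k + 1) t) * (D_op a b w k f x / w (k + 1) x)
      + integral {a..b} (\<lambda>t. r_iter a b x w p (Suc k) t * D_op a b w (Suc k) f t)"
proof -
  define u h where "u t = w (Suc k) t * r_iter a b x w p k t"
    and "h t = 1 / w (Suc k) t * D_op a b w k f t" for t
  have u: "u absolutely_integrable_on {a..b}"
    unfolding u_def by (rule weighted_r_iter_absolutely_integrable[OF p x \<open>k < n\<close>])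
  have h: "abs_cont_on a b h"
    unfolding h_def by (rule has_abs_cont_deriv_abs_cont[OF ab D_op_quotient_regular[OF f \<open>k < n\<close>]])
  have "integral {a..b} (\<lambda>t. r_iter a b x w p k t * D_op a b w k f t) = integral {a..b} (\<lambda>t. u t * h t)"
  proof (rule integral_cong)
    fix t assume "t \<in> {a..b}"
    then have "w (Suc k) t > 0" using w_pos[of "Suc k" t] \<open>k < n\<close> by simp
    then show "r_iter a b x w p k t * D_op a b w k f t = u t * h t" by (simp add: u_def h_def)
  qed
  also have "\<dots> = h x * integral {a..b} u + integral {a..b} (\<lambda>t. r_op a b x u t * deriv_within a b h t)"
    by (rule integral_mult_abs_cont[OF ab u h x])
  finally show ?thesis by (simp add: u_def[abs_def] h_def[abs_def] mult.commute)
qed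

proposition remainder_formula:
  assumes p: "p absolutely_integrable_on {a..b}" and x: "x \<in> {a..b}"
    and f: "has_abs_cont_deriv a b (n - 1) f"
  shows "integral {a..b} (\<lambda>t. p t * f t)
      - (\<Sum>k<n. integral {a..b} (\<lambda>t. r_iter a b x w p k t * w (k + 1) t) * (D_op a b w k f x / w (k + 1) x))
    = integral {a..b} (\<lambda>t. r_iter a b x w p n t * D_op a b w n f t)"
proof -
  have "integral {a..b} (\<lambda>t. p t * f t)
      - (\<Sum>k<m. integral {a..b} (\<lambda>t. r_iter a b x w p k t * w (k + 1) t) * (D_op a b w k f x / w (k + 1) x))
    = integral {a..b} (\<lambda>t. r_iter a b x w p m t * D_op a b w m f t)" if "m \<le> n" for m
    using that
  proof (induction m)
    case (Suc m)
    then have "m < n" by simp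
    from remainder_step[OF p x f this] Suc show ?case
      unfolding sum.lessThan_Suc by linarith
  qed simp
  then show ?thesis by simp
qed

lemma nested_integral_regular:
  assumes g: "g absolutely_integrable_on {a..b}" and "j < n"
  shows "has_abs_cont_deriv a b j (nested_integral a w n g (Suc j))"
  using \<open>j < n\<close>
proof (induction j)
  case 0
  then show ?case
    using abs_cont_on_mult[OF has_abs_cont_deriv_abs_cont[OF ab w_smooth[of n]] abs_cont_on_indefinite_integral[OF g]]
    by (simp add: has_abs_cont_deriv_0)
next
  case (Suc j)
  have "has_abs_cont_deriv a b (Suc j) (w (n - Suc j))"
    using w_smooth[of "n - Suc j"] Suc.prems by simp
  moreover have "has_abs_cont_deriv a b (Suc j) (\<lambda>t. integral {a..t} (nested_integral a w n g (Suc j)))"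
    using Suc by (intro has_abs_cont_deriv_integral[OF ab]) simp
  ultimately show ?case
    by (subst nested_integral.simps(2)) (rule has_abs_cont_deriv_mult[OF ab])
qed

text \<open>Dividing \<open>D\<^sub>k f\<close> by \<open>w\<^sub>k\<^sub>+\<^sub>1\<close> leaves a pure integral. For \<open>k + 1 < n\<close> the integrand is
continuous, so that differentiation restores it at every point; the case \<open>k + 1 = n\<close>, whose
integrand is only integrable, is not differentiated here.\<close>

lemma D_op_nested_integral_quotient:
  assumes g: "g absolutely_integrable_on {a..b}" and "k < n" "t \<in> {a..b}"
  shows "1 / w (Suc k) t * D_op a b w k (nested_integral a w n g n) t
    = integral {a..t} (nested_integral a w n g (n - Suc k))"
  using assms(2,3)
proof (induction k arbitrary: t)
  case 0
  then obtain m where n: "n = Suc m" by (cases n) auto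
  have "nested_integral a w n g n t = w 1 t * integral {a..t} (nested_integral a w n g m)"
    unfolding n by simp
  then show ?case using w_pos[of 1 t] 0 by (simp add: n)
next
  case (Suc k)
  define m where "m = n - Suc (Suc k)"
  have m: "n - Suc k = Suc m" "n - m = Suc (Suc k)" "m < n" using Suc.prems by (auto simp: m_def)
  have "D_op a b w (Suc k) (nested_integral a w n g n) t
      = deriv_within a b (\<lambda>s. integral {a..s} (nested_integral a w n g (Suc m))) t"
    unfolding D_op.simps using Suc m by (intro deriv_within_cong) auto
  also have "\<dots> = nested_integral a w n g (Suc m) t"
    using Suc.prems m
    by (intro deriv_within_eqI[OF ab] has_real_derivative_integral_continuous abs_cont_on_continuous
        has_abs_cont_deriv_abs_cont[OF ab nested_integral_regular[OF g]]) auto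
  also have "\<dots> = w (Suc (Suc k)) t * integral {a..t} (nested_integral a w n g m)"
    by (simp add: m)
  finally show ?case
    using w_pos[of "Suc (Suc k)" t] Suc.prems by (simp add: m_def)
qed

text \<open>The last differentiation acts on the indefinite integral of \<open>g\<close> itself, whose derivative is
\<open>g\<close> off a negligible set.\<close>

proposition prescribed_D_op:
  assumes g: "g absolutely_integrable_on {a..b}" and "n \<ge> 1"
  obtains f N where "has_abs_cont_deriv a b (n - 1) f" "negligible N"
    "\<And>t. t \<in> {a..b} - N \<Longrightarrow> D_op a b w n f t = g t"
proof
  let ?f = "nested_integral a w n g n"
  let ?N = "{t\<in>{a..b}. \<not> ((\<lambda>s. integral {a..s} g) has_real_derivative g t) (at t within {a..b})}"
  obtain m where n: "n = Suc m" using \<open>n \<ge> 1\<close> by (cases n) auto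
  show "has_abs_cont_deriv a b (n - 1) ?f"
    using nested_integral_regular[OF g, of m] n by simp
  show "negligible ?N" by (rule Lebesgue_differentiation[OF set_lebesgue_integral_eq_integral(1)[OF g]])
  show "D_op a b w n ?f t = g t" if t: "t \<in> {a..b} - ?N" for t
  proof -
    have "D_op a b w n ?f t = deriv_within a b (\<lambda>s. 1 / w (Suc m) s * D_op a b w m ?f s) t"
      by (subst (1) n) simp
    also have "\<dots> = deriv_within a b (\<lambda>s. integral {a..s} g) t"
      using D_op_nested_integral_quotient[OF g, of m] t n by (intro deriv_within_cong) auto
    also have "\<dots> = g t" using t by (intro deriv_within_eqI[OF ab]) auto
    finally show ?thesis .
  qed
qed

end

section \<open>Duality of Lebesgue spaces on an interval\<close>

lemma Lq_norm_le_1_iff: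
  assumes "1 \<le> q" "q \<noteq> \<infinity>"
  shows "Lq_norm a b q g \<le> 1 \<longleftrightarrow> (\<integral>\<^sup>+ t. ennreal (\<bar>g t\<bar> powr enn2real q) \<partial>lebesgue_on {a..b}) \<le> 1"
proof -
  let ?s = "enn2real q"
  define J where "J = (\<integral>\<^sup>+ t. ennreal (\<bar>g t\<bar> powr ?s) \<partial>lebesgue_on {a..b})"
  have "?s \<ge> 1" using assms by (cases q) auto
  have norm_eq: "Lq_norm a b q g = (if J = \<infinity> then \<infinity> else ennreal (enn2real J powr (1 / ?s)))"
    using assms(2) by (simp add: Lq_norm_def J_def)
  show ?thesis
  proof (cases J)
    case (real j)
    have "j powr (1 / ?s) \<le> 1 \<longleftrightarrow> j \<le> 1"
      using powr_mono2[of "1 / ?s" j 1] powr_less_mono2[of "1 / ?s" 1 j] \<open>?s \<ge> 1\<close> real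
      by (auto simp: not_le[symmetric])
    then show ?thesis using real by (simp add: norm_eq J_def[symmetric])
  qed (simp add: norm_eq J_def[symmetric])
qed

lemma Lq_norm_infinity_le_1_iff:
  assumes "g \<in> borel_measurable (lebesgue_on {a..b})"
  shows "Lq_norm a b \<infinity> g \<le> 1 \<longleftrightarrow> (AE t in lebesgue_on {a..b}. \<bar>g t\<bar> \<le> 1)"
proof
  assume "Lq_norm a b \<infinity> g \<le> 1"
  then have "esssup (lebesgue_on {a..b}) (\<lambda>t. ennreal \<bar>g t\<bar>) \<le> 1" by (simp add: Lq_norm_def)
  moreover have "AE t in lebesgue_on {a..b}. ennreal \<bar>g t\<bar> \<le> esssup (lebesgue_on {a..b}) (\<lambda>t. ennreal \<bar>g t\<bar>)"
    by (rule esssup_AE)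
  ultimately show "AE t in lebesgue_on {a..b}. \<bar>g t\<bar> \<le> 1"
    by (auto elim!: eventually_mono dest: order_trans)
next
  assume *: "AE t in lebesgue_on {a..b}. \<bar>g t\<bar> \<le> 1"
  have "esssup (lebesgue_on {a..b}) (\<lambda>t. ennreal \<bar>g t\<bar>) \<le> 1"
    using assms * by (intro esssup_I) auto
  then show "Lq_norm a b \<infinity> g \<le> 1" by (simp add: Lq_norm_def)
qed

lemma AE_lebesgue_onI:
  assumes "negligible N" "\<And>t. t \<in> {a..b} - N \<Longrightarrow> P t"
  shows "AE t in lebesgue_on {a..b::real}. P t"
proof -
  have "N \<in> null_sets lebesgue" using assms(1) by (simp add: negligible_iff_null_sets)
  then have "AE t in lebesgue. t \<notin> N" by (rule AE_not_in)
  then have "AE t in lebesgue. t \<in> {a..b} \<longrightarrow> P t"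
    by eventually_elim (use assms(2) in auto)
  then show ?thesis by (subst AE_restrict_space_iff) auto
qed

lemma Lq_norm_cong_AE:
  assumes f: "f \<in> borel_measurable (lebesgue_on {a..b})" and g: "g \<in> borel_measurable (lebesgue_on {a..b})"
    and eq: "AE t in lebesgue_on {a..b}. f t = g t"
  shows "Lq_norm a b q f = Lq_norm a b q g"
proof -
  have "esssup (lebesgue_on {a..b}) (\<lambda>t. ennreal \<bar>f t\<bar>) = esssup (lebesgue_on {a..b}) (\<lambda>t. ennreal \<bar>g t\<bar>)"
    using f g eq by (intro esssup_AE_cong) (auto elim!: eventually_mono)
  moreover have "(\<integral>\<^sup>+ t. ennreal (\<bar>f t\<bar> powr s) \<partial>lebesgue_on {a..b})
      = (\<integral>\<^sup>+ t. ennreal (\<bar>g t\<bar> powr s) \<partial>lebesgue_on {a..b})" for s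
    using eq by (intro nn_integral_cong_AE) (auto elim!: eventually_mono)
  ultimately show ?thesis by (simp add: Lq_norm_def)
qed

lemma integrable_on_interval_iff:
  fixes f :: "real \<Rightarrow> real"
  shows "integrable (lebesgue_on {a..b}) f \<longleftrightarrow> f absolutely_integrable_on {a..b}"
  by (simp add: integrable_restrict_space set_integrable_def)

lemma set_integral_lebesgue_on:
  fixes f :: "real \<Rightarrow> real"
  shows "(LINT t:{a..b}|lebesgue. f t) = (\<integral>t. f t \<partial>lebesgue_on {a..b})"
  by (simp add: integral_restrict_space set_lebesgue_integral_def)

text \<open>The interval has finite measure, and \<open>g\<close> is bounded almost everywhere if \<open>q = \<infinity>\<close>, while
\<open>\<bar>g\<bar> \<le> 1 + \<bar>g\<bar>\<^sup>q\<close> for finite \<open>q\<close>.\<close>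

lemma Lq_unit_ball_integrable:
  assumes "1 \<le> q" and g: "g \<in> Lq_unit_ball a b q"
  shows "integrable (lebesgue_on {a..b}) g"
proof -
  let ?M = "lebesgue_on {a..b}"
  have [measurable]: "g \<in> borel_measurable ?M" and le1: "Lq_norm a b q g \<le> 1"
    using g by (auto simp: Lq_unit_ball_def)
  have fin: "emeasure ?M (space ?M) < \<infinity>"
    by (simp add: emeasure_restrict_space emeasure_lborel_Icc_eq)
  have "(\<integral>\<^sup>+ t. ennreal (norm (g t)) \<partial>?M) < \<infinity>"
  proof (cases "q = \<infinity>")
    case True
    then have "AE t in ?M. \<bar>g t\<bar> \<le> 1" using le1 Lq_norm_infinity_le_1_iff[of g a b] by simp
    then have "(\<integral>\<^sup>+ t. ennreal (norm (g t)) \<partial>?M) \<le> (\<integral>\<^sup>+ t. 1 \<partial>?M)"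
      by (intro nn_integral_mono_AE) (auto elim!: eventually_mono)
    then show ?thesis using fin by (simp add: le_less_trans)
  next
    case False
    let ?s = "enn2real q"
    have "?s \<ge> 1" using False \<open>1 \<le> q\<close> by (cases q) auto
    have "ennreal (norm (g t)) \<le> 1 + ennreal (\<bar>g t\<bar> powr ?s)" for t
    proof -
      have "\<bar>g t\<bar> \<le> 1 + \<bar>g t\<bar> powr ?s"
      proof (cases "\<bar>g t\<bar> \<le> 1")
        case False
        then have "\<bar>g t\<bar> powr 1 \<le> \<bar>g t\<bar> powr ?s" using \<open>?s \<ge> 1\<close> by (intro powr_mono) auto
        then show ?thesis by simp
      qed (simp add: add_increasing2)
      then have "ennreal (norm (g t)) \<le> ennreal (1 + \<bar>g t\<bar> powr ?s)" by (intro ennreal_leI) simp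
      then show ?thesis by (simp add: ennreal_plus)
    qed
    then have "(\<integral>\<^sup>+ t. ennreal (norm (g t)) \<partial>?M) \<le> (\<integral>\<^sup>+ t. 1 + ennreal (\<bar>g t\<bar> powr ?s) \<partial>?M)"
      by (intro nn_integral_mono)
    also have "\<dots> = emeasure ?M (space ?M) + (\<integral>\<^sup>+ t. ennreal (\<bar>g t\<bar> powr ?s) \<partial>?M)"
      by (subst nn_integral_add) auto
    also have "\<dots> < \<infinity>"
      using fin le1 Lq_norm_le_1_iff[OF \<open>1 \<le> q\<close> False, of a b g] by (auto simp: less_top[symmetric] top_unique)
    finally show ?thesis .
  qed
  then show ?thesis by (intro integrableI_bounded) auto
qed

lemma integrable_bounded_interval:
  fixes f :: "real \<Rightarrow> real"
  assumes "f \<in> borel_measurable (lebesgue_on {a..b})" "\<And>t. t \<in> {a..b} \<Longrightarrow> \<bar>f t\<bar> \<le> B"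
  shows "integrable (lebesgue_on {a..b}) f"
proof -
  interpret finite_measure "lebesgue_on {a..b}" by (intro finite_measure_lebesgue_on) simp
  show ?thesis using assms by (intro integrable_const_bound[of _ B]) auto
qed

text \<open>The supremum over the \<open>L\<^sub>1\<close> ball need not be attained. For a level \<open>c\<close> below the essential
supremum of \<open>\<bar>r\<bar>\<close>, the set where \<open>\<bar>r\<bar> > c\<close> has positive measure, and the normalised
indicator of this set with the sign of \<open>r\<close> gives at least \<open>c\<close>.\<close>

lemma esssup_le_dual_sup:
  assumes r: "r \<in> borel_measurable (lebesgue_on {a..b})" and B: "\<And>t. t \<in> {a..b} \<Longrightarrow> \<bar>r t\<bar> \<le> B"
  shows "Lq_norm a b \<infinity> r \<le> (SUP g\<in>Lq_unit_ball a b 1. ennreal \<bar>\<integral>t. r t * g t \<partial>lebesgue_on {a..b}\<bar>)"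
proof (rule dense_le)
  let ?M = "lebesgue_on {a..b}"
  interpret finite_measure ?M by (intro finite_measure_lebesgue_on) simp
  note r[measurable]
  fix c assume c: "c < Lq_norm a b \<infinity> r"
  then have c_less: "c < esssup ?M (\<lambda>t. ennreal \<bar>r t\<bar>)" by (simp add: Lq_norm_def)
  then obtain c' where c': "c = ennreal c'" "c' \<ge> 0" by (cases c) auto
  define E where "E = {t\<in>space ?M. \<bar>r t\<bar> > c'}"
  have E_meas [measurable]: "E \<in> sets ?M" unfolding E_def by measurable
  have "emeasure ?M {t\<in>space ?M. ennreal \<bar>r t\<bar> > c} > 0"
    by (rule esssup_pos_measure[OF _ c_less]) simp
  also have "{t\<in>space ?M. ennreal \<bar>r t\<bar> > c} = E"
    using c' by (auto simp: E_def ennreal_less_iff)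
  finally have m: "measure ?M E > 0" by (simp add: emeasure_eq_measure)
  define m where "m = measure ?M E"
  define g where "g t = sgn (r t) * indicator E t / m" for t
  have [measurable]: "g \<in> borel_measurable ?M" unfolding g_def by measurable
  have "m > 0" using m by (simp add: m_def)
  have abs_g: "\<bar>g t\<bar> = indicator E t / m" for t
    using c' \<open>m > 0\<close> by (auto simp: g_def E_def indicator_def abs_mult abs_sgn_eq)
  have "(\<integral>\<^sup>+ t. ennreal (\<bar>g t\<bar> powr enn2real 1) \<partial>?M) = (\<integral>\<^sup>+ t. ennreal (1 / m) * indicator E t \<partial>?M)"
    using \<open>m > 0\<close> by (intro nn_integral_cong) (auto simp: abs_g indicator_def)
  also have "\<dots> = ennreal (1 / m) * ennreal m"
    by (simp add: emeasure_eq_measure m_def nn_integral_cmult_indicator)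
  also have "\<dots> = 1" using \<open>m > 0\<close> by (simp flip: ennreal_mult)
  finally have "g \<in> Lq_unit_ball a b 1"
    using Lq_norm_le_1_iff[of 1 a b g] by (simp add: Lq_unit_ball_def)
  moreover have "c' \<le> (\<integral>t. r t * g t \<partial>?M)"
  proof -
    have rg: "r t * g t = \<bar>r t\<bar> * (indicator E t / m)" for t
      by (simp add: g_def abs_sgn mult.assoc)
    have "c' = (\<integral>t. c' * (indicator E t / m) \<partial>?M)"
      using \<open>m > 0\<close> E_meas sets.sets_into_space[OF E_meas] by (simp add: m_def Int_absorb2)
    also have "\<dots> \<le> (\<integral>t. r t * g t \<partial>?M)"
    proof (rule integral_mono)
      show "integrable ?M (\<lambda>t. c' * (indicator E t / m))"
        by (intro integrable_mult_right integrable_divide_zero integrable_real_indicator) (auto simp: emeasure_eq_measure)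
      have "\<bar>r t * g t\<bar> \<le> B * (1 / m)" if "t \<in> {a..b}" for t
        unfolding abs_mult abs_g using B[OF that] \<open>m > 0\<close>
        by (intro mult_mono) (auto simp: indicator_def intro: order_trans[OF abs_ge_zero])
      then show "integrable ?M (\<lambda>t. r t * g t)"
        by (intro integrable_bounded_interval) auto
      show "c' * (indicator E t / m) \<le> r t * g t" for t
        unfolding rg using \<open>m > 0\<close> by (auto simp: E_def indicator_def intro!: divide_right_mono)
    qed
    finally show ?thesis .
  qed
  then have "c \<le> ennreal \<bar>\<integral>t. r t * g t \<partial>?M\<bar>" unfolding c' by (intro ennreal_leI) simp
  ultimately show "c \<le> (SUP g\<in>Lq_unit_ball a b 1. ennreal \<bar>\<integral>t. r t * g t \<partial>?M\<bar>)"
    by (intro SUP_upper2)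
qed

lemma conjugate_exponent_cases:
  fixes q q' :: ennreal
  assumes "1 \<le> q" "1 / q + 1 / q' = 1"
  obtains "q = 1" "q' = \<infinity>" | "q = \<infinity>" "q' = 1"
  | s s' where "q = ennreal s" "q' = ennreal s'" "s > 1" "s' > 1" "1 / s + 1 / s' = 1"
proof -
  have "q' \<noteq> 0"
  proof
    assume "q' = 0"
    then have "1 / q + 1 / q' = top" by simp
    then show False using assms(2) by simp
  qed
  consider "q = \<infinity>" | "q = 1" | s where "q = ennreal s" "s > 1"
  proof (cases q)
    case (real s)
    then have "s \<ge> 1" using assms(1) by simp
    then show ?thesis using that real by (cases "s = 1") auto
  qed (use that in auto)
  then show thesis
  proof cases
    case 1
    then have "1 / q' = 1" using assms(2) by simp
    then have "q' = 1" using one_divide_one_divide_ennreal[of q'] by simp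
    with 1 show ?thesis using that by blast
  next
    case 2
    then have "1 + 1 / q' = 1 + 0" using assms(2) by simp
    then have "1 / q' = 0" unfolding ennreal_add_left_cancel by simp
    then have "q' = \<infinity>" by simp
    with 2 show ?thesis using that by blast
  next
    case (3 s)
    then have q: "1 / q = ennreal (1 / s)" using divide_ennreal[of 1 s] by simp
    show ?thesis
    proof (cases q')
      case (real s')
      then have "s' > 0" using \<open>q' \<noteq> 0\<close> by (cases "s' = 0") auto
      then have "1 / q' = ennreal (1 / s')" using divide_ennreal[of 1 s'] real by simp
      then have "ennreal (1 / s + 1 / s') = 1"
        using assms(2) q \<open>s > 1\<close> \<open>s' > 0\<close> by (simp add: ennreal_plus)
      then have eq: "1 / s + 1 / s' = 1" by simp
      moreover have "s' > 1"
      proof -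
        have "1 / s' < 1" using eq \<open>s > 1\<close> by (smt (verit) zero_less_divide_1_iff)
        then show ?thesis using \<open>s' > 0\<close> by simp
      qed
      ultimately show ?thesis using that 3 real by blast
    next
      case top
      then have "ennreal (1 / s) = 1" using assms(2) q by simp
      then show ?thesis using 3 by simp
    qed
  qed
qed

text \<open>That the norm is an upper bound is Hoelder's inequality. For exponents strictly between 1 and
\<open>\<infinity>\<close> it is obtained by integrating Young's inequality for \<open>\<bar>r\<bar> / L\<close> and \<open>\<bar>g\<bar>\<close>, where
\<open>L\<close> is the norm of \<open>r\<close>. In this range the supremum is attained at the normalised function
\<open>sgn r * \<bar>r\<bar> powr (s' - 1)\<close>, and for \<open>q = \<infinity>\<close> at \<open>sgn r\<close>.\<close>

theorem Lq_duality:
  assumes q: "1 \<le> q" "1 / q + 1 / q' = 1"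
    and r: "r \<in> borel_measurable (lebesgue_on {a..b})" and bdd: "bounded (r ` {a..b})"
  shows "(SUP g\<in>Lq_unit_ball a b q. ennreal \<bar>\<integral>t. r t * g t \<partial>lebesgue_on {a..b}\<bar>) = Lq_norm a b q' r"
proof -
  let ?M = "lebesgue_on {a..b}"
  note r[measurable]
  obtain B where B: "\<And>t. t \<in> {a..b} \<Longrightarrow> \<bar>r t\<bar> \<le> B"
    using bdd unfolding bounded_iff by (metis imageI real_norm_def)
  have pairing_le: "ennreal \<bar>\<integral>t. r t * g t \<partial>?M\<bar> \<le> (\<integral>\<^sup>+ t. ennreal \<bar>r t * g t\<bar> \<partial>?M)" for g
  proof (cases "integrable ?M (\<lambda>t. r t * g t)")
    case True
    then show ?thesis using integral_norm_bound_ennreal[OF True] by simp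
  qed (simp add: not_integrable_integral_eq)
  consider "q = 1" "q' = \<infinity>" | "q = \<infinity>" "q' = 1"
    | s s' where "q = ennreal s" "q' = ennreal s'" "s > 1" "s' > 1" "1 / s + 1 / s' = 1"
    using conjugate_exponent_cases[OF q] by blast
  then show ?thesis
  proof cases
    case 1
    show ?thesis
    proof (rule antisym)
      show "(SUP g\<in>Lq_unit_ball a b q. ennreal \<bar>\<integral>t. r t * g t \<partial>?M\<bar>) \<le> Lq_norm a b q' r"
      proof (rule SUP_least)
        fix g assume "g \<in> Lq_unit_ball a b q"
        then have [measurable]: "g \<in> borel_measurable ?M" and g1: "(\<integral>\<^sup>+ t. ennreal \<bar>g t\<bar> \<partial>?M) \<le> 1"
          using Lq_norm_le_1_iff[of 1 a b g] 1 by (auto simp: Lq_unit_ball_def)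
        define S where "S = esssup ?M (\<lambda>t. ennreal \<bar>r t\<bar>)"
        have "AE t in ?M. ennreal \<bar>r t\<bar> \<le> S" unfolding S_def by (rule esssup_AE)
        then have "(\<integral>\<^sup>+ t. ennreal \<bar>r t * g t\<bar> \<partial>?M) \<le> (\<integral>\<^sup>+ t. S * ennreal \<bar>g t\<bar> \<partial>?M)"
          by (intro nn_integral_mono_AE) (auto simp: abs_mult ennreal_mult elim!: eventually_mono intro: mult_right_mono)
        also have "\<dots> = S * (\<integral>\<^sup>+ t. ennreal \<bar>g t\<bar> \<partial>?M)" by (rule nn_integral_cmult) simp
        also have "\<dots> \<le> S * 1" using g1 by (rule mult_left_mono) simp
        finally have "(\<integral>\<^sup>+ t. ennreal \<bar>r t * g t\<bar> \<partial>?M) \<le> S" by simp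
        from order_trans[OF pairing_le this] show "ennreal \<bar>\<integral>t. r t * g t \<partial>?M\<bar> \<le> Lq_norm a b q' r"
          using 1 by (simp add: Lq_norm_def S_def)
      qed
      show "Lq_norm a b q' r \<le> (SUP g\<in>Lq_unit_ball a b q. ennreal \<bar>\<integral>t. r t * g t \<partial>?M\<bar>)"
        using esssup_le_dual_sup[OF r B] 1 by simp
    qed
  next
    case 2
    have int_r: "integrable ?M (\<lambda>t. \<bar>r t\<bar>)" using B by (intro integrable_bounded_interval[of _ _ _ B]) auto
    have norm_r: "Lq_norm a b q' r = (\<integral>\<^sup>+ t. ennreal \<bar>r t\<bar> \<partial>?M)"
      using 2 int_r by (simp add: Lq_norm_def nn_integral_eq_integral)
    show ?thesis
    proof (rule antisym)
      show "(SUP g\<in>Lq_unit_ball a b q. ennreal \<bar>\<integral>t. r t * g t \<partial>?M\<bar>) \<le> Lq_norm a b q' r"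
      proof (rule SUP_least)
        fix g assume "g \<in> Lq_unit_ball a b q"
        then have "AE t in ?M. \<bar>g t\<bar> \<le> 1"
          using Lq_norm_infinity_le_1_iff[of g a b] 2 by (auto simp: Lq_unit_ball_def)
        then have "(\<integral>\<^sup>+ t. ennreal \<bar>r t * g t\<bar> \<partial>?M) \<le> (\<integral>\<^sup>+ t. ennreal \<bar>r t\<bar> \<partial>?M)"
          by (intro nn_integral_mono_AE)
            (auto simp: abs_mult elim!: eventually_mono intro!: ennreal_leI mult_left_le)
        from order_trans[OF pairing_le this] show "ennreal \<bar>\<integral>t. r t * g t \<partial>?M\<bar> \<le> Lq_norm a b q' r"
          unfolding norm_r .
      qed
      have "(\<lambda>t. sgn (r t)) \<in> Lq_unit_ball a b q"
        using Lq_norm_infinity_le_1_iff[of "\<lambda>t. sgn (r t)" a b] 2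
        by (auto simp: Lq_unit_ball_def abs_sgn_eq)
      then have "ennreal \<bar>\<integral>t. r t * sgn (r t) \<partial>?M\<bar> \<le> (SUP g\<in>Lq_unit_ball a b q. ennreal \<bar>\<integral>t. r t * g t \<partial>?M\<bar>)"
        by (rule SUP_upper)
      moreover have "Lq_norm a b q' r = ennreal \<bar>\<integral>t. r t * sgn (r t) \<partial>?M\<bar>"
        unfolding norm_r using int_r by (simp add: abs_sgn[symmetric] nn_integral_eq_integral)
      ultimately show "Lq_norm a b q' r \<le> (SUP g\<in>Lq_unit_ball a b q. ennreal \<bar>\<integral>t. r t * g t \<partial>?M\<bar>)"
        by simp
    qed
  next
    case (3 s s')
    have q_fin: "q \<noteq> \<infinity>" "q' \<noteq> \<infinity>" "enn2real q = s" "enn2real q' = s'" using 3 by auto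
    have conj: "(s' - 1) * s = s'" "1 - 1 / s = 1 / s'" using 3 by (auto simp: field_simps)
    have B0: "\<bar>r t\<bar> powr e \<le> max 0 B powr e" if "t \<in> {a..b}" "e \<ge> 0" for t e
      using B[OF that(1)] that(2) by (intro powr_mono2) auto
    have int_r: "integrable ?M (\<lambda>t. \<bar>r t\<bar> powr s')"
      using B0 3 by (intro integrable_bounded_interval[of _ _ _ "max 0 B powr s'"]) auto
    define A where "A = (\<integral>t. \<bar>r t\<bar> powr s' \<partial>?M)"
    have nn_A: "(\<integral>\<^sup>+ t. ennreal (\<bar>r t\<bar> powr s') \<partial>?M) = ennreal A"
      unfolding A_def using int_r by (intro nn_integral_eq_integral) auto
    have "A \<ge> 0" unfolding A_def by (intro integral_nonneg_AE) simp
    \<comment> \<open>The norm of \<open>r\<close>, finite because \<open>r\<close> is bounded.\<close>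
    define L where "L = A powr (1 / s')"
    have norm_r: "Lq_norm a b q' r = ennreal L"
      using q_fin \<open>A \<ge> 0\<close> by (simp add: Lq_norm_def nn_A L_def)
    show ?thesis
    proof (cases "A = 0")
      case True
      have "AE t in ?M. ennreal (\<bar>r t\<bar> powr s') = 0"
        using nn_A True by (subst nn_integral_0_iff_AE[symmetric]) auto
      then have "AE t in ?M. r t = 0" by (auto elim!: eventually_mono)
      then have zero: "(\<integral>t. r t * g t \<partial>?M) = 0" for g
        by (intro integral_eq_zero_AE) (auto elim!: eventually_mono)
      have "(\<lambda>_. 0) \<in> Lq_unit_ball a b q"
        using Lq_norm_le_1_iff[OF q(1) q_fin(1), of a b "\<lambda>_. 0"] by (simp add: Lq_unit_ball_def)
      then have "Lq_unit_ball a b q \<noteq> {}" by blast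
      then show ?thesis using True by (simp add: norm_r L_def zero)
    next
      case False
      then have "A > 0" "L > 0" using \<open>A \<ge> 0\<close> by (auto simp: L_def)
      have L_powr: "L powr s' = A" using \<open>A > 0\<close> 3 by (simp add: L_def powr_powr)
      show ?thesis
      proof (rule antisym)
        show "(SUP g\<in>Lq_unit_ball a b q. ennreal \<bar>\<integral>t. r t * g t \<partial>?M\<bar>) \<le> Lq_norm a b q' r"
        proof (rule SUP_least)
          fix g assume "g \<in> Lq_unit_ball a b q"
          then have [measurable]: "g \<in> borel_measurable ?M"
            and g1: "(\<integral>\<^sup>+ t. ennreal (\<bar>g t\<bar> powr s) \<partial>?M) \<le> 1"
            using Lq_norm_le_1_iff[OF q(1) q_fin(1), of a b g] q_fin by (auto simp: Lq_unit_ball_def)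
          have young: "\<bar>r t * g t\<bar> \<le> L / (s' * A) * \<bar>r t\<bar> powr s' + L / s * \<bar>g t\<bar> powr s" for t
          proof -
            have "(\<bar>r t\<bar> / L) * \<bar>g t\<bar> \<le> (\<bar>r t\<bar> / L) powr s' / s' + \<bar>g t\<bar> powr s / s"
              using 3 \<open>L > 0\<close> by (intro Youngs_inequality) (auto simp: add.commute)
            then have "L * ((\<bar>r t\<bar> / L) * \<bar>g t\<bar>) \<le> L * ((\<bar>r t\<bar> / L) powr s' / s' + \<bar>g t\<bar> powr s / s)"
              using \<open>L > 0\<close> by (intro mult_left_mono) auto
            then show ?thesis
              using \<open>L > 0\<close> by (simp add: powr_divide L_powr abs_mult distrib_left mult.commute)
          qed
          have "(\<integral>\<^sup>+ t. ennreal \<bar>r t * g t\<bar> \<partial>?M)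
              \<le> (\<integral>\<^sup>+ t. ennreal (L / (s' * A)) * ennreal (\<bar>r t\<bar> powr s') + ennreal (L / s) * ennreal (\<bar>g t\<bar> powr s) \<partial>?M)"
          proof (rule nn_integral_mono)
            have split: "ennreal (c * y + d * z) = ennreal c * ennreal y + ennreal d * ennreal z"
              if "c \<ge> 0" "d \<ge> 0" "y \<ge> 0" "z \<ge> 0" for c d y z :: real
              using that by (simp add: ennreal_plus ennreal_mult)
            show "ennreal \<bar>r t * g t\<bar> \<le> ennreal (L / (s' * A)) * ennreal (\<bar>r t\<bar> powr s')
                + ennreal (L / s) * ennreal (\<bar>g t\<bar> powr s)" for t
              using ennreal_leI[OF young[of t]] 3 \<open>L > 0\<close> \<open>A > 0\<close> by (subst split[symmetric]) auto
          qed
          also have "\<dots> = ennreal (L / (s' * A)) * ennreal A + ennreal (L / s) * (\<integral>\<^sup>+ t. ennreal (\<bar>g t\<bar> powr s) \<partial>?M)"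
            by (subst nn_integral_add) (auto simp: nn_integral_cmult nn_A)
          also have "\<dots> \<le> ennreal (L / (s' * A)) * ennreal A + ennreal (L / s) * 1"
            using g1 by (intro add_left_mono mult_left_mono) auto
          also have "\<dots> = ennreal (L / (s' * A) * A + L / s)"
            using 3 \<open>L > 0\<close> \<open>A > 0\<close> by (simp add: ennreal_plus ennreal_mult[symmetric])
          also have "L / (s' * A) * A + L / s = L * (1 / s + 1 / s')"
            using \<open>A > 0\<close> by (simp add: distrib_left)
          also have "\<dots> = L" using 3 by simp
          finally show "ennreal \<bar>\<integral>t. r t * g t \<partial>?M\<bar> \<le> Lq_norm a b q' r"
            unfolding norm_r using order_trans[OF pairing_le] by blast
        qed
        define g where "g t = sgn (r t) * \<bar>r t\<bar> powr (s' - 1) / A powr (1 / s)" for t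
        have [measurable]: "g \<in> borel_measurable ?M" unfolding g_def by measurable
        have abs_g: "\<bar>g t\<bar> powr s = \<bar>r t\<bar> powr s' / A" for t
          using 3 \<open>A > 0\<close> by (auto simp: g_def abs_mult abs_sgn_eq powr_divide powr_powr conj)
        have "(\<integral>\<^sup>+ t. ennreal (\<bar>g t\<bar> powr s) \<partial>?M) = (\<integral>\<^sup>+ t. ennreal (1 / A) * ennreal (\<bar>r t\<bar> powr s') \<partial>?M)"
          using \<open>A > 0\<close> by (intro nn_integral_cong) (simp add: abs_g ennreal_mult[symmetric])
        also have "\<dots> = ennreal (1 / A) * ennreal A"
          by (simp add: nn_integral_cmult nn_A)
        also have "\<dots> = 1" using \<open>A > 0\<close> by (simp flip: ennreal_mult)
        finally have "g \<in> Lq_unit_ball a b q"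
          using Lq_norm_le_1_iff[OF q(1) q_fin(1), of a b g] q_fin by (simp add: Lq_unit_ball_def)
        then have "ennreal \<bar>\<integral>t. r t * g t \<partial>?M\<bar> \<le> (SUP g\<in>Lq_unit_ball a b q. ennreal \<bar>\<integral>t. r t * g t \<partial>?M\<bar>)"
          by (rule SUP_upper)
        moreover have "(\<integral>t. r t * g t \<partial>?M) = L"
        proof -
          have "r t * g t = \<bar>r t\<bar> powr s' / A powr (1 / s)" for t
          proof -
            have "\<bar>r t\<bar> * \<bar>r t\<bar> powr (s' - 1) = \<bar>r t\<bar> powr s'"
              using 3 by (cases "r t = 0") (auto simp: powr_mult_base)
            then show ?thesis by (simp add: g_def abs_sgn mult.assoc[symmetric])
          qed
          then have "(\<integral>t. r t * g t \<partial>?M) = A / A powr (1 / s)" by (simp add: A_def)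
          also have "\<dots> = A powr (1 - 1 / s)" using \<open>A > 0\<close> by (simp add: powr_diff)
          finally show ?thesis by (simp add: L_def conj)
        qed
        ultimately show "Lq_norm a b q' r \<le> (SUP g\<in>Lq_unit_ball a b q. ennreal \<bar>\<integral>t. r t * g t \<partial>?M\<bar>)"
          using \<open>L > 0\<close> by (simp add: norm_r)
      qed
    qed
  qed
qed

section \<open>The extremal problem\<close>

theorem theorem3:
  fixes a b x :: real and n :: nat and q q' :: ennreal
    and p :: "real \<Rightarrow> real" and w :: "nat \<Rightarrow> real \<Rightarrow> real"
  assumes "a < b"
    and "n \<ge> 1"
    and "1 \<le> q"
    and "1 / q + 1 / q' = 1"
    and "x \<in> {a..b}"
    and "set_integrable lebesgue {a..b} p"
    and "\<And>k t. k \<in> {1..n} \<Longrightarrow> t \<in> {a..b} \<Longrightarrow> w k t > 0"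
    and "\<And>k. k \<in> {1..n} \<Longrightarrow> has_abs_cont_deriv a b (n - k) (w k)"
  shows "(SUP f\<in>D_class a b w n q.
            ennreal \<bar>(LINT t:{a..b}|lebesgue. p t * f t)
              - (\<Sum>k<n. (LINT t:{a..b}|lebesgue. r_iter a b x w p k t * w (k + 1) t)
                        * (D_op a b w k f x / w (k + 1) x))\<bar>)
          = (SUP g\<in>Lq_unit_ball a b q.
              ennreal \<bar>LINT t:{a..b}|lebesgue. r_iter a b x w p n t * g t\<bar>)
       \<and> (SUP g\<in>Lq_unit_ball a b q.
              ennreal \<bar>LINT t:{a..b}|lebesgue. r_iter a b x w p n t * g t\<bar>)
          = Lq_norm a b q' (r_iter a b x w p n)"
proof
  let ?M = "lebesgue_on {a..b}"
  define r where "r = r_iter a b x w p"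
  define err where "err f = (LINT t:{a..b}|lebesgue. p t * f t)
      - (\<Sum>k<n. (LINT t:{a..b}|lebesgue. r k t * w (k + 1) t) * (D_op a b w k f x / w (k + 1) x))" for f
  note w = assms(7,8)
  have r_meas: "r n \<in> borel_measurable ?M" and r_bdd: "bounded (r n ` {a..b})"
    unfolding r_def using r_iter_measurable_bounded[of a b n w p x] assms by auto
  have err_eq: "err f = (\<integral>t. r n t * D_op a b w n f t \<partial>?M)" if f: "f \<in> D_class a b w n q" for f
  proof -
    have reg: "has_abs_cont_deriv a b (n - 1) f" and cont: "continuous_on {a..b} f"
      and ball: "D_op a b w n f \<in> Lq_unit_ball a b q"
      using f by (auto simp: D_class_def)
    have "(\<lambda>t. f t * p t) absolutely_integrable_on {a..b}"
      by (rule absolutely_integrable_continuous_mult[OF cont assms(6)])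
    then have pf: "(\<lambda>t. p t * f t) absolutely_integrable_on {a..b}" by (simp add: mult.commute)
    have rw: "(\<lambda>t. r k t * w (k + 1) t) absolutely_integrable_on {a..b}" if "k < n" for k
      using weighted_r_iter_absolutely_integrable[OF assms(1) w assms(6,5) that]
      by (simp add: r_def mult.commute)
    have "D_op a b w n f absolutely_integrable_on {a..b}"
      using Lq_unit_ball_integrable[OF assms(3) ball] by (simp add: integrable_on_interval_iff)
    then have rD: "(\<lambda>t. r n t * D_op a b w n f t) absolutely_integrable_on {a..b}"
      by (intro absolutely_integrable_bounded_measurable_product_real r_meas r_bdd) auto
    have "err f = integral {a..b} (\<lambda>t. p t * f t)
      - (\<Sum>k<n. integral {a..b} (\<lambda>t. r k t * w (k + 1) t) * (D_op a b w k f x / w (k + 1) x))"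
      unfolding err_def using pf rw by (simp add: set_lebesgue_integral_eq_integral(2))
    also have "\<dots> = integral {a..b} (\<lambda>t. r n t * D_op a b w n f t)"
      unfolding r_def by (rule remainder_formula[OF assms(1) w assms(6,5) reg])
    also have "\<dots> = (\<integral>t. r n t * D_op a b w n f t \<partial>?M)"
      using set_lebesgue_integral_eq_integral(2)[OF rD] by (simp add: set_integral_lebesgue_on)
    finally show ?thesis .
  qed
  show "(SUP f\<in>D_class a b w n q. ennreal \<bar>(LINT t:{a..b}|lebesgue. p t * f t)
              - (\<Sum>k<n. (LINT t:{a..b}|lebesgue. r_iter a b x w p k t * w (k + 1) t)
                        * (D_op a b w k f x / w (k + 1) x))\<bar>)
      = (SUP g\<in>Lq_unit_ball a b q. ennreal \<bar>LINT t:{a..b}|lebesgue. r_iter a b x w p n t * g t\<bar>)"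
    unfolding r_def[symmetric] unfolding err_def[symmetric] unfolding set_integral_lebesgue_on
  proof (rule antisym; rule SUP_least)
    fix f assume f: "f \<in> D_class a b w n q"
    then have "D_op a b w n f \<in> Lq_unit_ball a b q" by (simp add: D_class_def)
    then show "ennreal \<bar>err f\<bar> \<le> (SUP g\<in>Lq_unit_ball a b q. ennreal \<bar>\<integral>t. r n t * g t \<partial>?M\<bar>)"
      unfolding err_eq[OF f] by (rule SUP_upper)
  next
    fix g assume g: "g \<in> Lq_unit_ball a b q"
    have g_int: "g absolutely_integrable_on {a..b}"
      using Lq_unit_ball_integrable[OF assms(3) g] by (simp add: integrable_on_interval_iff)
    obtain f N where f: "has_abs_cont_deriv a b (n - 1) f" and N: "negligible N"
      and eq: "\<And>t. t \<in> {a..b} - N \<Longrightarrow> D_op a b w n f t = g t"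
      using prescribed_D_op[OF assms(1) w g_int assms(2)] by blast
    have AE_eq: "AE t in ?M. D_op a b w n f t = g t"
      by (rule AE_lebesgue_onI[OF N eq])
    have "D_op a b w n f absolutely_integrable_on {a..b}"
      by (rule absolutely_integrable_spike[OF g_int N eq])
    then have D_meas: "D_op a b w n f \<in> borel_measurable ?M"
      using integrable_on_interval_iff borel_measurable_integrable by blast
    have g_meas: "g \<in> borel_measurable ?M" using g by (simp add: Lq_unit_ball_def)
    have "f \<in> D_class a b w n q"
      using f D_meas g Lq_norm_cong_AE[OF D_meas g_meas AE_eq, of q]
        abs_cont_on_continuous[OF has_abs_cont_deriv_abs_cont[OF assms(1) f]]
      by (simp add: D_class_def Lq_unit_ball_def)
    moreover have "(\<integral>t. r n t * g t \<partial>?M) = (\<integral>t. r n t * D_op a b w n f t \<partial>?M)"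
      using r_meas D_meas g_meas AE_eq by (intro integral_cong_AE) (auto elim!: eventually_mono)
    ultimately show "ennreal \<bar>\<integral>t. r n t * g t \<partial>?M\<bar> \<le> (SUP f\<in>D_class a b w n q. ennreal \<bar>err f\<bar>)"
      by (intro SUP_upper2[of f]) (auto simp: err_eq)
  qed
  show "(SUP g\<in>Lq_unit_ball a b q. ennreal \<bar>LINT t:{a..b}|lebesgue. r_iter a b x w p n t * g t\<bar>)
      = Lq_norm a b q' (r_iter a b x w p n)"
    unfolding r_def[symmetric] set_integral_lebesgue_on by (rule Lq_duality[OF assms(3,4) r_meas r_bdd])
qed

end
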